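(* Let $\mu>0$ and $H_{\max}>1$ be constants, and let constants $\sigma,q,k,\gamma,\beta>0$, $\lambda\in[0,1]$ be given. Let $T>0$ be a given constant and let $(\xi(t),w(t),h[t],v[t],\hat\xi(t),\hat w(t),z(t))\in X\times\mathbb R^3$, $t\in[0,T]$, be a classical smooth solution of the PDE-ODE system $$\dot\xi=w,\quad \dot w=-f,\quad h_t+(hv)_x=0,\quad (hv)_t+\left(hv^2+\tfrac12h^2\right)_x=\mu(hv_x)_x+hf,\quad x\in[0,1],$$ $$v(t,0)=v(t,1)=0,\qquad \int_0^1h(t,x)\,dx=1,$$ $$\frac{d\hat\xi}{dt}=\hat w-2\gamma(\hat\xi-\xi),\qquad \frac{d\hat w}{dt}=-f-\left(\tfrac12+\gamma^2\right)(\hat\xi-\xi),$$ $$\dot z=f-\tfrac12\left(h^2(t,1)-h^2(t,0)\right)-\beta\left(z-\mu(h(t,1)-h(t,0))\right),$$ $$f=-\sigma\left(2\lambda z+(1-2\lambda)\mu(h(t,1)-h(t,0))-q(\hat w+k\xi)+q\gamma(\hat\xi-\xi)\right).$$ Then there exists a constant $\bar M>0$ such that the following estimate holds for all sufficiently small $\delta t\in(0,T)$, $\delta x=1/n$: $$\begin{aligned}&|\xi^+-\xi(\delta t)|+|w^+-w(\delta t)|+|z^+-z(\delta t)|+|\hat\xi^+-\hat\xi(\delta t)|+|\hat w^+-\hat w(\delta t)|\\&\quad+\max_{i=0,\dots,n}\left(|h_i^+-h(\delta t,i\delta x)|+|v_i^+-v(\delta t,i\delta x)|\right)\le\bar M\,\delta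 t\left(\delta t+(\delta x)^2\right),\end{aligned}$$ where $n\ge2$ is an integer and $h_i^+,v_i^+$ $(i=0,\dots,n)$, $w^+,\xi^+,z^+,\hat\xi^+,\hat w^+$ are given by one step of the finite-difference scheme described in the context, with $h_i=h(0,i\delta x)$, $v_i=v(0,i\delta x)$ for $i=0,\dots,n$, $w=w(0)$, $\xi=\xi(0)$, $\hat\xi=\hat\xi(0)$, $\hat w=\hat w(0)$ and $z=z(0)$.
   Context: Finite-difference scheme (time step $\delta t>0$, space step $\delta x=1/n$, $n\ge 2$ an integer): $$h_0^+=h_0\exp\left(\tfrac{\delta t}{2\delta x}(v_2-4v_1)\right),\qquad h_n^+=h_n\exp\left(\tfrac{\delta t}{2\delta x}(4v_{n-1}-v_{n-2})\right),$$ $$h_i^+=h_i\exp\left(\tfrac{\delta t}{2\delta x}(v_{i-1}-v_{i+1})+\tfrac{\delta t}{2\delta x}v_i\ln\tfrac{h_{i-1}}{h_{i+1}}\right),\quad i=1,\dots,n-1,$$ $$\begin{aligned}v_i^+=&\left(1-\tfrac{2\delta t\,\mu}{(\delta x)^2}\right)v_i+\tfrac{\delta t\,\mu}{(\delta x)^2}(v_{i+1}+v_{i-1})+\tfrac{\delta t\,\mu}{4(\delta x)^2}(v_{i+1}-v_{i-1})\ln\tfrac{h_{i+1}}{h_{i-1}}\\&-\tfrac{\delta t}{2\delta x}\left(v_i(v_{i+1}-v_{i-1})+h_{i+1}-h_{i-1}\right)+f\,\delta t,\quad i=1,\dots,n-1,\end{aligned}$$ $$v_0^+=v_n^+=0,$$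 $$f=-\sigma\left(2\lambda z+(1-2\lambda)\mu(h_n-h_0)-q(\hat w+k\xi)+q\gamma(\hat\xi-\xi)\right),$$ $$\xi^+=\xi+\delta t\,w-\tfrac{(\delta t)^2}{2}f,\qquad w^+=w-\delta t\,f,$$ $$\hat\xi^+=\xi^++e^{-\gamma\delta t}\left(\cos\left(\tfrac{\delta t}{\sqrt2}\right)(\hat\xi-\xi)+\sqrt2\sin\left(\tfrac{\delta t}{\sqrt2}\right)\left(\hat w-w-\gamma(\hat\xi-\xi)\right)\right),$$ $$\hat w^+=w^++e^{-\gamma\delta t}\left(\cos\left(\tfrac{\delta t}{\sqrt2}\right)(\hat w-w)+\gamma\sqrt2\sin\left(\tfrac{\delta t}{\sqrt2}\right)\left(\hat w-w-\left(\gamma+\tfrac1{2\gamma}\right)(\hat\xi-\xi)\right)\right),$$ $$z^+=z+\delta t\left(f-\tfrac12(h_n^2-h_0^2)-\beta\left(z-\mu(h_n-h_0)\right)\right).$$ The constant $\bar M$ may depend on the solution, on $T$ and on the parameters, but not on $\delta t$ or $n$. Notation: $u[t]$ is the profile $x\mapsto u(t,x)$. The set $S$ consists of all $(\xi,w,h,v)$ with $(\xi,w)\in\mathbb R^2$, $h\in C^0([0,1];(0,+\infty))\cap H^1(0,1)$, $v\in C^0([0,1])$, $v(0)=v(1)=0$, $\int_0^1h\,dx=1$; $X:=\{(\xi,w,h,v)\in S:V(\xi,w,h,v)<R\}$, where $$V(\xi,w,h,v):=\tfrac12\int_0^1h^{-1}(hv+\mu h_x)^2dx+\tfrac12\int_0^1hv^2dx+\int_0^1(h-1)^2dx+\tfrac{qk^2}2\xi^2+\tfrac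 q2(w+k\xi)^2,$$ $$R:=\tfrac{2\mu}{3}\left(2+\sqrt{H_{\max}}\min(H_{\max}-3,0)\right).$$ "Classical smooth solution" means a solution (with $h>0$) whose components have continuous derivatives of sufficiently large order, for $h,v$ on $[0,T]\times[0,1]$ and for $\xi,w,\hat\xi,\hat w,z$ on $[0,T]$. *)

theory Defs
  imports "HOL-Analysis.Analysis"
begin

section \<open>Continuous differentiability of finite order on closed sets\<close>

text \<open>
  \<open>Ck_on N S f\<close>: all derivatives of \<open>f\<close> up to order \<open>N\<close> exist on \<open>S\<close> and are continuous there.
  Derivatives are taken within \<open>S\<close>, hence are one-sided at the boundary; on the intervals
  and rectangles used below they are uniquely determined.
\<close>

primrec Ck_on :: "nat \<Rightarrow> 'a::euclidean_space set \<Rightarrow> ('a \<Rightarrow> real) \<Rightarrow> bool" where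
  "Ck_on 0 S f \<longleftrightarrow> continuous_on S f"
| "Ck_on (Suc N) S f \<longleftrightarrow>
     (\<exists>D. (\<forall>x\<in>S. (f has_derivative D x) (at x within S)) \<and> (\<forall>d. Ck_on N S (\<lambda>x. D x d)))"

text \<open>
  Partial derivatives on \<open>[0,T] \<times> [0,1]\<close>, one-sided on the boundary. They are meaningful only where
  the derivative exists; below they are applied to functions that are smooth on that rectangle.
\<close>

definition partial_t :: "real \<Rightarrow> (real \<Rightarrow> real \<Rightarrow> real) \<Rightarrow> real \<Rightarrow> real \<Rightarrow> real" where
  "partial_t T u t x = vector_derivative (\<lambda>s. u s x) (at t within {0..T})"

definition partial_x :: "(real \<Rightarrow> real \<Rightarrow> real) \<Rightarrow> real \<Rightarrow> real \<Rightarrow> real" where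
  "partial_x u t x = vector_derivative (\<lambda>y. u t y) (at x within {0..1})"


section \<open>The Sobolev space \<open>H\<^sup>1(0,1)\<close>\<close>

definition test_function :: "(real \<Rightarrow> real) \<Rightarrow> bool" where
  "test_function \<phi> \<longleftrightarrow> (\<forall>N. Ck_on N UNIV \<phi>) \<and> closure {x. \<phi> x \<noteq> 0} \<subseteq> {0<..<1}"

definition L2_on_unit :: "(real \<Rightarrow> real) \<Rightarrow> bool" where
  "L2_on_unit g \<longleftrightarrow> g \<in> borel_measurable (lebesgue_on {0<..<1})
     \<and> integrable (lebesgue_on {0<..<1}) (\<lambda>x. (g x)\<^sup>2)"

definition is_weak_deriv :: "(real \<Rightarrow> real) \<Rightarrow> (real \<Rightarrow> real) \<Rightarrow> bool" where
  "is_weak_deriv h g \<longleftrightarrow> L2_on_unit g \<and>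
     (\<forall>\<phi>. test_function \<phi> \<longrightarrow>
        (LINT x|lebesgue_on {0<..<1}. h x * deriv \<phi> x) = - (LINT x|lebesgue_on {0<..<1}. g x * \<phi> x))"

definition in_H1 :: "(real \<Rightarrow> real) \<Rightarrow> bool" where
  "in_H1 h \<longleftrightarrow> L2_on_unit h \<and> (\<exists>g. is_weak_deriv h g)"

text \<open>
  A representative of the weak derivative; it is unique up to null sets, so integrals of
  expressions in it do not depend on the choice.
\<close>

definition weak_deriv :: "(real \<Rightarrow> real) \<Rightarrow> real \<Rightarrow> real" where
  "weak_deriv h = (SOME g. is_weak_deriv h g)"


section \<open>State space and Lyapunov functional\<close>

definition state_space :: "(real \<times> real \<times> (real \<Rightarrow> real) \<times> (real \<Rightarrow> real)) set" where
  "state_space = {(xi, w, h, v).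
     continuous_on {0..1} h \<and> (\<forall>x\<in>{0..1}. h x > 0) \<and> in_H1 h
     \<and> continuous_on {0..1} v \<and> v 0 = 0 \<and> v 1 = 0
     \<and> (LINT x|lebesgue_on {0..1}. h x) = 1}"

definition V_fun ::
  "real \<Rightarrow> real \<Rightarrow> real \<Rightarrow> real \<Rightarrow> real \<Rightarrow> (real \<Rightarrow> real) \<Rightarrow> (real \<Rightarrow> real) \<Rightarrow> real" where
  "V_fun \<mu> q k xi w h v =
     1/2 * (LINT x|lebesgue_on {0<..<1}. (h x * v x + \<mu> * weak_deriv h x)\<^sup>2 / h x)
     + 1/2 * (LINT x|lebesgue_on {0<..<1}. h x * (v x)\<^sup>2)
     + (LINT x|lebesgue_on {0<..<1}. (h x - 1)\<^sup>2)
     + q * k\<^sup>2 / 2 * xi\<^sup>2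
     + q / 2 * (w + k * xi)\<^sup>2"

definition R_bound :: "real \<Rightarrow> real \<Rightarrow> real" where
  "R_bound \<mu> Hmax = 2 * \<mu> / 3 * (2 + sqrt Hmax * min (Hmax - 3) 0)"

definition X_set ::
  "real \<Rightarrow> real \<Rightarrow> real \<Rightarrow> real \<Rightarrow> (real \<times> real \<times> (real \<Rightarrow> real) \<times> (real \<Rightarrow> real)) set" where
  "X_set \<mu> Hmax q k =
     {(xi, w, h, v). (xi, w, h, v) \<in> state_space \<and> V_fun \<mu> q k xi w h v < R_bound \<mu> Hmax}"


section \<open>The closed-loop system\<close>

text \<open>
  \<open>h0\<close> and \<open>h1\<close> are the liquid levels at the left and the right wall;
  \<open>xih\<close> and \<open>wh\<close> are the observer states for \<open>xi\<close> and \<open>w\<close>.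
\<close>

definition feedback ::
  "real \<Rightarrow> real \<Rightarrow> real \<Rightarrow> real \<Rightarrow> real \<Rightarrow> real
   \<Rightarrow> real \<Rightarrow> real \<Rightarrow> real \<Rightarrow> real \<Rightarrow> real \<Rightarrow> real \<Rightarrow> real" where
  "feedback \<mu> \<sigma> q k \<gamma> lam xi h0 h1 xih wh z =
     - \<sigma> * (2 * lam * z + (1 - 2 * lam) * \<mu> * (h1 - h0) - q * (wh + k * xi) + q * \<gamma> * (xih - xi))"

definition classical_solution ::
  "nat \<Rightarrow> real \<Rightarrow> real \<Rightarrow> real \<Rightarrow> real \<Rightarrow> real \<Rightarrow> real \<Rightarrow> real \<Rightarrow> real
   \<Rightarrow> (real \<Rightarrow> real) \<Rightarrow> (real \<Rightarrow> real) \<Rightarrow> (real \<Rightarrow> real \<Rightarrow> real) \<Rightarrow> (real \<Rightarrow> real \<Rightarrow> real)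
   \<Rightarrow> (real \<Rightarrow> real) \<Rightarrow> (real \<Rightarrow> real) \<Rightarrow> (real \<Rightarrow> real) \<Rightarrow> bool" where
  "classical_solution N T \<mu> \<sigma> q k \<gamma> \<beta> lam xi w h v xih wh z \<longleftrightarrow>
    (let f = (\<lambda>t. feedback \<mu> \<sigma> q k \<gamma> lam (xi t) (h t 0) (h t 1) (xih t) (wh t) (z t)) in
      Ck_on N ({0..T} \<times> {0..1}) (\<lambda>(t, x). h t x) \<and>
      Ck_on N ({0..T} \<times> {0..1}) (\<lambda>(t, x). v t x) \<and>
      Ck_on N {0..T} xi \<and> Ck_on N {0..T} w \<and>
      Ck_on N {0..T} xih \<and> Ck_on N {0..T} wh \<and> Ck_on N {0..T} z \<and>
      (\<forall>t\<in>{0..T}. \<forall>x\<in>{0..1}. h t x > 0) \<and>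
      (\<forall>t\<in>{0..T}. \<forall>x\<in>{0..1}.
         partial_t T h t x + partial_x (\<lambda>t x. h t x * v t x) t x = 0 \<and>
         partial_t T (\<lambda>t x. h t x * v t x) t x
           + partial_x (\<lambda>t x. h t x * (v t x)\<^sup>2 + 1/2 * (h t x)\<^sup>2) t x
         = \<mu> * partial_x (\<lambda>t x. h t x * partial_x v t x) t x + h t x * f t) \<and>
      (\<forall>t\<in>{0..T}.
         v t 0 = 0 \<and> v t 1 = 0 \<and>
         (LINT x|lebesgue_on {0..1}. h t x) = 1 \<and>
         (xi has_real_derivative w t) (at t within {0..T}) \<and>
         (w has_real_derivative - f t) (at t within {0..T}) \<and>
         (xih has_real_derivative wh t - 2 * \<gamma> * (xih t - xi t)) (at t within {0..T}) \<and>
         (wh has_real_derivative - f t - (1/2 + \<gamma>\<^sup>2) * (xih t - xi t)) (at t within {0..T}) \<and>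
         (z has_real_derivative
            f t - 1/2 * ((h t 1)\<^sup>2 - (h t 0)\<^sup>2) - \<beta> * (z t - \<mu> * (h t 1 - h t 0)))
           (at t within {0..T})))"


section \<open>One step of the finite-difference scheme\<close>

text \<open>
  Grid functions are maps \<open>nat \<Rightarrow> real\<close>, of which only the values at \<open>0, \<dots>, n\<close> matter;
  \<open>dt\<close> is the time step and \<open>dx\<close> the space step.
\<close>

definition h_step :: "nat \<Rightarrow> real \<Rightarrow> real \<Rightarrow> (nat \<Rightarrow> real) \<Rightarrow> (nat \<Rightarrow> real) \<Rightarrow> nat \<Rightarrow> real" where
  "h_step n dt dx h v i =
     (if i = 0 then h 0 * exp (dt / (2 * dx) * (v 2 - 4 * v 1))
      else if i = n then h n * exp (dt / (2 * dx) * (4 * v (n - 1) - v (n - 2)))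
      else h i * exp (dt / (2 * dx) * (v (i - 1) - v (i + 1))
                      + dt / (2 * dx) * v i * ln (h (i - 1) / h (i + 1))))"

definition v_step ::
  "nat \<Rightarrow> real \<Rightarrow> real \<Rightarrow> real \<Rightarrow> real \<Rightarrow> (nat \<Rightarrow> real) \<Rightarrow> (nat \<Rightarrow> real) \<Rightarrow> nat \<Rightarrow> real" where
  "v_step n dt dx \<mu> f h v i =
     (if i = 0 \<or> i = n then 0
      else (1 - 2 * dt * \<mu> / dx\<^sup>2) * v i
           + dt * \<mu> / dx\<^sup>2 * (v (i + 1) + v (i - 1))
           + dt * \<mu> / (4 * dx\<^sup>2) * (v (i + 1) - v (i - 1)) * ln (h (i + 1) / h (i - 1))
           - dt / (2 * dx) * (v i * (v (i + 1) - v (i - 1)) + h (i + 1) - h (i - 1))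
           + f * dt)"

definition xi_step :: "real \<Rightarrow> real \<Rightarrow> real \<Rightarrow> real \<Rightarrow> real" where
  "xi_step dt f xi w = xi + dt * w - dt\<^sup>2 / 2 * f"

definition w_step :: "real \<Rightarrow> real \<Rightarrow> real \<Rightarrow> real" where
  "w_step dt f w = w - dt * f"

definition xih_step :: "real \<Rightarrow> real \<Rightarrow> real \<Rightarrow> real \<Rightarrow> real \<Rightarrow> real \<Rightarrow> real \<Rightarrow> real" where
  "xih_step dt \<gamma> f xi w xih wh =
     xi_step dt f xi w
     + exp (- \<gamma> * dt) * (cos (dt / sqrt 2) * (xih - xi)
         + sqrt 2 * sin (dt / sqrt 2) * (wh - w - \<gamma> * (xih - xi)))"

definition wh_step :: "real \<Rightarrow> real \<Rightarrow> real \<Rightarrow> real \<Rightarrow> real \<Rightarrow> real \<Rightarrow> real \<Rightarrow> real" where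
  "wh_step dt \<gamma> f xi w xih wh =
     w_step dt f w
     + exp (- \<gamma> * dt) * (cos (dt / sqrt 2) * (wh - w)
         + \<gamma> * sqrt 2 * sin (dt / sqrt 2) * (wh - w - (\<gamma> + 1 / (2 * \<gamma>)) * (xih - xi)))"

definition z_step :: "real \<Rightarrow> real \<Rightarrow> real \<Rightarrow> real \<Rightarrow> real \<Rightarrow> real \<Rightarrow> real \<Rightarrow> real" where
  "z_step dt \<mu> \<beta> f h0 hn z =
     z + dt * (f - 1/2 * (hn\<^sup>2 - h0\<^sup>2) - \<beta> * (z - \<mu> * (hn - h0)))"

end

theory Submission
  imports Defs
begin

text \<open>
  One step of the scheme is first order in time, so only the expansion
  \<open>u(s, x) = u(0, x) + s u\<^sub>t(0, x) + O(s\<^sup>2)\<close> matters, and \<open>u\<^sub>t(0, \<cdot>)\<close> is given by the equations.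
  In the non-conservative form \<open>h\<^sub>t = h (- v\<^sub>x - v (ln h)\<^sub>x)\<close> and
  \<open>v\<^sub>t = \<mu> v\<^sub>x\<^sub>x + \<mu> v\<^sub>x (ln h)\<^sub>x - v v\<^sub>x - h\<^sub>x + f\<close> the scheme replaces every space derivative
  by a second order difference quotient: central in the interior, three-point one-sided for \<open>v\<^sub>x\<close> at
  the walls, where \<open>v = 0\<close>. The observer update adds to the plant update the exact flow of the linear
  error system, a damped oscillation of frequency \<open>1 / sqrt 2\<close>.
  Four derivatives of the solution suffice.
\<close>

section \<open>Taylor expansions from finite-order smoothness\<close>

text \<open>Unfolding \<open>Ck_on\<close> once yields a total derivative whose value in each fixed
  direction is again smooth of one order less. Following the same direction \<open>d\<close> at
  every order gives a chain of iterated directional derivatives. Only the value of each total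
  derivative at \<open>d\<close> is recorded, so the derivative itself may stay existential.\<close>

lemma Ck_on_directional_derivs:
  assumes "Ck_on N S f"
  shows "\<exists>g. g 0 = f \<and>
    (\<forall>i<N. \<forall>x\<in>S. \<exists>D. (g i has_derivative D) (at x within S) \<and> D d = g (Suc i) x) \<and>
    (\<forall>i\<le>N. continuous_on S (g i))"
  using assms
proof (induction N arbitrary: f)
  case 0
  then show ?case by (intro exI[of _ "\<lambda>_. f"]) auto
next
  case (Suc N)
  then obtain D where D: "\<forall>x\<in>S. (f has_derivative D x) (at x within S)"
    and ck: "\<forall>d. Ck_on N S (\<lambda>x. D x d)"
    unfolding Ck_on.simps by blast
  obtain g where g0: "g 0 = (\<lambda>x. D x d)"
    and g1: "\<forall>i<N. \<forall>x\<in>S. \<exists>D. (g i has_derivative D) (at x within S) \<and> D d = g (Suc i) x"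
    and g2: "\<forall>i\<le>N. continuous_on S (g i)"
    using Suc.IH[OF ck[rule_format, of d]] by (elim exE conjE) (rule that)
  have "continuous_on S f"
    by (rule has_derivative_continuous_on[of S f D]) (simp add: D)
  define g' where "g' = case_nat f g"
  have "\<exists>D. (g' i has_derivative D) (at x within S) \<and> D d = g' (Suc i) x" if "i < Suc N" "x \<in> S" for i x
  proof (cases i)
    case 0
    then show ?thesis using D that g0 by (intro exI[of _ "D x"]) (simp add: g'_def)
  next
    case (Suc j)
    then show ?thesis using g1 that by (simp add: g'_def)
  qed
  moreover have "continuous_on S (g' i)" if "i \<le> Suc N" for i
    using that \<open>continuous_on S f\<close> g2 by (cases i) (simp_all add: g'_def)
  moreover have "g' 0 = f"
    by (simp add: g'_def)
  ultimately show ?case by (intro exI[of _ g']) simp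
qed

text \<open>Along the path \<open>p + r d\<close> the chain rule turns the directional chain into
  ordinary derivatives in one real variable, and compactness of \<open>S\<close> gives one bound for
  all orders. The same statement then serves functions of time alone as well as the time and space
  directions of the rectangle. The parameter set \<open>A\<close> is free, so derivatives at its end
  points are one-sided.\<close>

lemma Ck_on_line_derivs:
  fixes f :: "'a::euclidean_space \<Rightarrow> real"
  assumes "Ck_on N S f" "compact S"
  shows "\<exists>g K. g 0 = f \<and> (\<forall>i\<le>N. \<forall>x\<in>S. \<bar>g i x\<bar> \<le> K) \<and>
    (\<forall>i<N. \<forall>p A. (\<forall>r\<in>A. p + r *\<^sub>R d \<in> S) \<longrightarrow> (\<forall>s\<in>A.
       ((\<lambda>r. g i (p + r *\<^sub>R d)) has_real_derivative g (Suc i) (p + s *\<^sub>R d)) (at s within A)))"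
proof -
  obtain g where g: "g 0 = f"
    "\<And>i x. i < N \<Longrightarrow> x \<in> S \<Longrightarrow> \<exists>D. (g i has_derivative D) (at x within S) \<and> D d = g (Suc i) x"
    "\<And>i. i \<le> N \<Longrightarrow> continuous_on S (g i)"
    using Ck_on_directional_derivs[OF assms(1), of d] by blast
  have "\<exists>B. \<forall>x\<in>S. \<bar>g i x\<bar> \<le> B" if "i \<le> N" for i
  proof -
    have "bounded (g i ` S)"
      using compact_continuous_image[OF g(3)[OF that] assms(2)] compact_imp_bounded by blast
    then show ?thesis by (auto simp: bounded_iff)
  qed
  then obtain B where B: "\<And>i x. i \<le> N \<Longrightarrow> x \<in> S \<Longrightarrow> \<bar>g i x\<bar> \<le> B i"
    by metis
  define K where "K = Max (B ` {..N})"
  have K: "\<bar>g i x\<bar> \<le> K" if "i \<le> N" "x \<in> S" for i x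
  proof -
    have "B i \<le> K" unfolding K_def using that by (intro Max_ge) auto
    with B[OF that] show ?thesis by linarith
  qed
  have der: "((\<lambda>r. g i (p + r *\<^sub>R d)) has_real_derivative g (Suc i) (p + s *\<^sub>R d)) (at s within A)"
    if line: "i < N" "\<And>r. r \<in> A \<Longrightarrow> p + r *\<^sub>R d \<in> S" "s \<in> A" for i p A s
  proof -
    obtain D where D: "(g i has_derivative D) (at (p + s *\<^sub>R d) within S)" "D d = g (Suc i) (p + s *\<^sub>R d)"
      using g(2)[OF line(1) line(2)[OF line(3)]] by blast
    have "((\<lambda>r. p + r *\<^sub>R d) has_derivative (\<lambda>r. r *\<^sub>R d)) (at s within A)"
      by (auto intro!: derivative_eq_intros)
    moreover have "(g i has_derivative D) (at (p + s *\<^sub>R d) within (\<lambda>r. p + r *\<^sub>R d) ` A)"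
      using D(1) line(2) by (auto intro: has_derivative_subset)
    ultimately have "((\<lambda>r. g i (p + r *\<^sub>R d)) has_derivative (\<lambda>r. D (r *\<^sub>R d))) (at s within A)"
      by (rule has_derivative_in_compose)
    moreover have "D (r *\<^sub>R d) = g (Suc i) (p + s *\<^sub>R d) * r" for r
      using D(2) linear_scale[OF has_derivative_linear[OF D(1)], of r d] by simp
    ultimately show ?thesis
      by (simp add: has_field_derivative_def)
  qed
  show ?thesis
  proof (intro exI[of _ g] exI[of _ K] conjI allI impI ballI)
    fix i p A s assume "i < N" "\<forall>r\<in>A. p + r *\<^sub>R d \<in> S" "s \<in> A"
    then show "((\<lambda>r. g i (p + r *\<^sub>R d)) has_real_derivative g (Suc i) (p + s *\<^sub>R d)) (at s within A)"
      by (intro der) simp_all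
  qed (use g K in simp_all)
qed

text \<open>This is \<open>field_Taylor\<close> of order one. Its remainder is divided by
  \<open>fact 1\<close>, hence the factor \<open>K\<close> in place of the sharp
  \<open>K / 2\<close>; only the existence of some constant matters later.\<close>

lemma taylor_order1:
  fixes f f' f'' :: "real \<Rightarrow> real"
  assumes "\<And>s. s \<in> {0..T} \<Longrightarrow> (f has_real_derivative f' s) (at s within {0..T})"
    and "\<And>s. s \<in> {0..T} \<Longrightarrow> (f' has_real_derivative f'' s) (at s within {0..T})"
    and "\<And>s. s \<in> {0..T} \<Longrightarrow> \<bar>f'' s\<bar> \<le> K" and "s \<in> {0..T}"
  shows "\<bar>f s - f 0 - s * f' 0\<bar> \<le> K * s\<^sup>2"
proof -
  define F where "F i = (if i = 0 then f else if i = 1 then f' else f'')" for i :: nat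
  have "norm (F 0 s - (\<Sum>i\<le>1. F i 0 * (s - 0) ^ i / fact i)) \<le> K * norm (s - 0) ^ Suc 1 / fact 1"
  proof (rule field_Taylor[where S = "{0..T}"])
    show "(F i has_field_derivative F (Suc i) x) (at x within {0..T})"
      if "x \<in> {0..T}" "i \<le> 1" for i x
      using that assms(1,2) unfolding F_def by (cases "i = 0") auto
  qed (use assms in \<open>auto simp: F_def\<close>)
  then show ?thesis
    using assms(4) by (simp add: F_def algebra_simps power2_eq_square)
qed

lemma real_derivative_unique_within_interval:
  fixes f :: "real \<Rightarrow> real"
  assumes "(f has_real_derivative D) (at x within {a..b})" "(f has_real_derivative E) (at x within {a..b})"
    and "a < b" "x \<in> {a..b}"
  shows "D = E"
  using assms vector_derivative_unique_within_closed_interval[of a b x f D E]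
  by (simp add: has_real_derivative_iff_has_vector_derivative)

lemma Ck_on_taylor_order1:
  fixes f :: "real \<Rightarrow> real"
  assumes "Ck_on N {0..T} f" "N \<ge> 2" "0 < T" and "(f has_real_derivative f') (at 0 within {0..T})"
  obtains K where "\<And>s. s \<in> {0..T} \<Longrightarrow> \<bar>f s - f 0 - s * f'\<bar> \<le> K * s\<^sup>2"
proof -
  obtain g K where g0: "g 0 = f" and K: "\<forall>i\<le>N. \<forall>x\<in>{0..T}. \<bar>g i x\<bar> \<le> K"
    and der: "\<forall>i<N. \<forall>p A. (\<forall>r\<in>A. p + r *\<^sub>R (1::real) \<in> {0..T}) \<longrightarrow> (\<forall>s\<in>A.
       ((\<lambda>r. g i (p + r *\<^sub>R 1)) has_real_derivative g (Suc i) (p + s *\<^sub>R 1)) (at s within A))"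
    using Ck_on_line_derivs[OF assms(1) compact_Icc, of 1] by (elim exE conjE) (rule that)
  have d: "(g i has_real_derivative g (Suc i) s) (at s within {0..T})" if "i < N" "s \<in> {0..T}" for i s
    using der[rule_format, of i "{0..T}" 0 s] that by simp
  \<comment> \<open>The chain \<open>g\<close> comes from an existential statement. Uniqueness of
    the one-sided derivative at 0 identifies its first member there with the slope
    \<open>f'\<close>, which later is read off from the differential equation.\<close>
  have "g 1 0 = f'"
    using d[of 0 0] assms(2-4) g0 by (intro real_derivative_unique_within_interval[of f _ 0 0 T]) auto
  moreover have "\<bar>f s - f 0 - s * g 1 0\<bar> \<le> K * s\<^sup>2" if s: "s \<in> {0..T}" for s
  proof (rule taylor_order1[OF _ _ _ s])
    show "(f has_real_derivative g 1 r) (at r within {0..T})" if "r \<in> {0..T}" for r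
      using d[of 0 r] that assms(2) g0 by simp
    show "(g 1 has_real_derivative g 2 r) (at r within {0..T})" if "r \<in> {0..T}" for r
      using d[of 1 r] that assms(2) by (simp add: numeral_2_eq_2)
    show "\<bar>g 2 r\<bar> \<le> K" if "r \<in> {0..T}" for r
      using K that assms(2) by simp
  qed
  ultimately have "\<bar>f s - f 0 - s * f'\<bar> \<le> K * s\<^sup>2" if "s \<in> {0..T}" for s
    using that by simp
  then show ?thesis by (rule that)
qed

text \<open>Damped oscillations with fixed damping and frequency form a two-parameter family closed
  under differentiation: the derivative acts linearly on the coefficient pair \<open>(a, c)\<close>.
  The second derivative is thus again such an oscillation, with coefficients \<open>a2\<close> and
  \<open>c2\<close>. For \<open>s \<ge> 0\<close> the damping factor is at most 1, so it is bounded
  by the sum of the absolute coefficients.\<close>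

lemma damped_oscillation_taylor_order1:
  fixes \<gamma> \<omega> a c :: real
  assumes "\<gamma> \<ge> 0"
  obtains K where "\<And>s. s \<ge> 0 \<Longrightarrow>
    \<bar>exp (- \<gamma> * s) * (cos (s * \<omega>) * a + sin (s * \<omega>) * c) - a - s * (c * \<omega> - \<gamma> * a)\<bar> \<le> K * s\<^sup>2"
proof -
  define \<phi> where "\<phi> a c s = exp (- \<gamma> * s) * (cos (s * \<omega>) * a + sin (s * \<omega>) * c)" for a c s
  define da where "da a c = c * \<omega> - \<gamma> * a" for a c
  define dc where "dc a c = - a * \<omega> - \<gamma> * c" for a c
  have der: "(\<phi> a c has_real_derivative \<phi> (da a c) (dc a c) s) (at s within A)" for a c s A
    unfolding \<phi>_def da_def dc_def
    by (auto intro!: derivative_eq_intros simp: algebra_simps)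
  have bound: "\<bar>\<phi> a c s\<bar> \<le> \<bar>a\<bar> + \<bar>c\<bar>" if "s \<ge> 0" for a c s
  proof -
    have "\<bar>cos (s * \<omega>) * a + sin (s * \<omega>) * c\<bar> \<le> \<bar>cos (s * \<omega>)\<bar> * \<bar>a\<bar> + \<bar>sin (s * \<omega>)\<bar> * \<bar>c\<bar>"
      by (metis abs_mult abs_triangle_ineq)
    also have "\<dots> \<le> 1 * \<bar>a\<bar> + 1 * \<bar>c\<bar>"
      by (intro add_mono mult_right_mono) auto
    finally have "\<bar>cos (s * \<omega>) * a + sin (s * \<omega>) * c\<bar> \<le> \<bar>a\<bar> + \<bar>c\<bar>" by simp
    moreover have "\<bar>exp (- \<gamma> * s)\<bar> \<le> 1"
      using assms that by simp
    ultimately have "\<bar>\<phi> a c s\<bar> \<le> 1 * (\<bar>a\<bar> + \<bar>c\<bar>)"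
      unfolding \<phi>_def abs_mult by (intro mult_mono) auto
    then show ?thesis by simp
  qed
  define a2 where "a2 = da (da a c) (dc a c)"
  define c2 where "c2 = dc (da a c) (dc a c)"
  have "\<bar>\<phi> a c s - \<phi> a c 0 - s * \<phi> (da a c) (dc a c) 0\<bar> \<le> (\<bar>a2\<bar> + \<bar>c2\<bar>) * s\<^sup>2" if "s \<ge> 0" for s
    using that
    by (intro taylor_order1[where T = s and f'' = "\<phi> a2 c2"])
       (auto intro: der bound simp: a2_def c2_def)
  moreover have "\<phi> a c 0 = a" "\<phi> (da a c) (dc a c) 0 = c * \<omega> - \<gamma> * a"
    by (simp_all add: \<phi>_def da_def)
  ultimately show ?thesis
    using that[of "\<bar>a2\<bar> + \<bar>c2\<bar>"] by (simp add: \<phi>_def)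
qed

section \<open>Difference quotients\<close>

text \<open>Carrying the derivatives as an explicit sequence lets \<open>F 1\<close>,
  \<open>F 2\<close> and so on name one-sided derivatives at the end points, and lets a single
  constant bound all orders at once.\<close>

definition derivs_on :: "nat \<Rightarrow> real set \<Rightarrow> (nat \<Rightarrow> real \<Rightarrow> real) \<Rightarrow> real \<Rightarrow> bool" where
  "derivs_on m S F K \<longleftrightarrow>
    (\<forall>i<m. \<forall>x\<in>S. (F i has_real_derivative F (Suc i) x) (at x within S)) \<and> (\<forall>i\<le>m. \<forall>x\<in>S. \<bar>F i x\<bar> \<le> K)"

lemma derivs_on_bound: "derivs_on m S F K \<Longrightarrow> i \<le> m \<Longrightarrow> x \<in> S \<Longrightarrow> \<bar>F i x\<bar> \<le> K"
  by (simp add: derivs_on_def)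

lemma derivs_on_mono: "derivs_on m S F K \<Longrightarrow> K \<le> K' \<Longrightarrow> m' \<le> m \<Longrightarrow> derivs_on m' S F K'"
  unfolding derivs_on_def by (meson order.trans less_le_trans)

lemma derivs_on_taylor:
  assumes "derivs_on (Suc n) S F K" "convex S" "x \<in> S" "x + d \<in> S"
  shows "\<bar>F 0 (x + d) - (\<Sum>i\<le>n. F i x * d ^ i / fact i)\<bar> \<le> K * \<bar>d\<bar> ^ Suc n / fact n"
proof -
  have "norm (F 0 (x + d) - (\<Sum>i\<le>n. F i x * (x + d - x) ^ i / fact i)) \<le> K * norm (x + d - x) ^ Suc n / fact n"
    using assms by (intro field_Taylor[where S = S]) (auto simp: derivs_on_def)
  then show ?thesis by simp
qed

text \<open>In the difference of the expansions at \<open>x + d\<close> and \<open>x - d\<close> the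
  even-order terms cancel. A cubic remainder is left, and division by \<open>2 * d\<close> makes it
  quadratic.\<close>

lemma central_difference:
  assumes "derivs_on 3 S F K" "convex S" "x \<in> S" "x + d \<in> S" "x - d \<in> S" "d > 0"
  shows "\<bar>(F 0 (x + d) - F 0 (x - d)) / (2 * d) - F 1 x\<bar> \<le> K * d\<^sup>2"
proof -
  have F: "derivs_on (Suc 2) S F K" using assms(1) by (simp add: numeral_3_eq_3 numeral_2_eq_2)
  have p: "\<bar>F 0 (x + d) - (F 0 x + F 1 x * d + F 2 x * d\<^sup>2 / 2)\<bar> \<le> K * d ^ 3 / 2"
    using derivs_on_taylor[OF F, of x d] assms by (simp add: numeral_3_eq_3 numeral_2_eq_2)
  have m: "\<bar>F 0 (x - d) - (F 0 x - F 1 x * d + F 2 x * d\<^sup>2 / 2)\<bar> \<le> K * d ^ 3 / 2"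
    using derivs_on_taylor[OF F, of x "- d"] assms by (simp add: numeral_3_eq_3 numeral_2_eq_2)
  have "\<bar>F 0 (x + d) - F 0 (x - d) - 2 * (F 1 x * d)\<bar> \<le> K * d ^ 3"
    using p m by linarith
  moreover have "K * d ^ 3 \<le> K * d\<^sup>2 * (2 * d)"
    using derivs_on_bound[OF assms(1), of 0 x] assms(3,6)
    by (simp add: power3_eq_cube power2_eq_square)
  moreover have "(F 0 (x + d) - F 0 (x - d)) / (2 * d) - F 1 x
      = (F 0 (x + d) - F 0 (x - d) - 2 * (F 1 x * d)) / (2 * d)"
    using assms(6) by (simp add: field_simps)
  ultimately show ?thesis
    using assms(6) by (simp add: abs_divide pos_divide_le_eq)
qed

text \<open>In the sum of the two expansions the odd-order terms cancel, including the cubic one.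
  The remainder is therefore of fourth order, and division by the square of \<open>d\<close> leaves
  a quadratic error.\<close>

lemma second_difference:
  assumes "derivs_on 4 S F K" "convex S" "x \<in> S" "x + d \<in> S" "x - d \<in> S" "d > 0"
  shows "\<bar>(F 0 (x + d) + F 0 (x - d) - 2 * F 0 x) / d\<^sup>2 - F 2 x\<bar> \<le> K * d\<^sup>2"
proof -
  have F: "derivs_on (Suc 3) S F K" using assms(1) by (simp add: eval_nat_numeral)
  have p: "\<bar>F 0 (x + d) - (F 0 x + F 1 x * d + F 2 x * d\<^sup>2 / 2 + F 3 x * d ^ 3 / 6)\<bar> \<le> K * d ^ 4 / 6"
    using derivs_on_taylor[OF F, of x d] assms by (simp add: eval_nat_numeral)
  have m: "\<bar>F 0 (x - d) - (F 0 x - F 1 x * d + F 2 x * d\<^sup>2 / 2 - F 3 x * d ^ 3 / 6)\<bar> \<le> K * d ^ 4 / 6"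
    using derivs_on_taylor[OF F, of x "- d"] assms by (simp add: eval_nat_numeral)
  have "0 \<le> K"
    using derivs_on_bound[OF assms(1), of 0 x] assms(3) by simp
  then have "0 \<le> K * d ^ 4" by simp
  with p m have "\<bar>F 0 (x + d) + F 0 (x - d) - 2 * F 0 x - F 2 x * d\<^sup>2\<bar> \<le> K * d ^ 4"
    by linarith
  moreover have "K * d ^ 4 = K * d\<^sup>2 * d\<^sup>2"
    by (simp add: eval_nat_numeral)
  moreover have "(F 0 (x + d) + F 0 (x - d) - 2 * F 0 x) / d\<^sup>2 - F 2 x
      = (F 0 (x + d) + F 0 (x - d) - 2 * F 0 x - F 2 x * d\<^sup>2) / d\<^sup>2"
    using assms(6) by (simp add: field_simps)
  ultimately show ?thesis
    using assms(6) by (simp add: abs_divide pos_divide_le_eq)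
qed

text \<open>The step \<open>d\<close> may be negative, which covers both end points of the interval.\<close>

lemma one_sided_difference:
  assumes "derivs_on 3 S F K" "convex S" "x \<in> S" "x + d \<in> S" "x + 2 * d \<in> S" "d \<noteq> 0"
  shows "\<bar>(4 * F 0 (x + d) - F 0 (x + 2 * d) - 3 * F 0 x) / (2 * d) - F 1 x\<bar> \<le> 3 * K * d\<^sup>2"
proof -
  have F: "derivs_on (Suc 2) S F K" using assms(1) by (simp add: numeral_3_eq_3 numeral_2_eq_2)
  have p: "\<bar>F 0 (x + d) - (F 0 x + F 1 x * d + F 2 x * d\<^sup>2 / 2)\<bar> \<le> K * \<bar>d\<bar> ^ 3 / 2"
    using derivs_on_taylor[OF F, of x d] assms by (simp add: eval_nat_numeral)
  have m: "\<bar>F 0 (x + 2 * d) - (F 0 x + 2 * (F 1 x * d) + 2 * (F 2 x * d\<^sup>2))\<bar> \<le> 4 * (K * \<bar>d\<bar> ^ 3)"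
    using derivs_on_taylor[OF F, of x "2 * d"] assms
    by (simp add: eval_nat_numeral abs_mult algebra_simps)
  \<comment> \<open>The weights 4 and -1 make the second-derivative terms cancel. The remainders
    contribute 4 * (1/2) + 4 = 6 multiples of \<open>K * \<bar>d\<bar> ^ 3\<close>.\<close>
  have "\<bar>4 * F 0 (x + d) - F 0 (x + 2 * d) - 3 * F 0 x - 2 * (F 1 x * d)\<bar> \<le> 6 * (K * \<bar>d\<bar> ^ 3)"
    using p m by linarith
  moreover have "6 * (K * \<bar>d\<bar> ^ 3) = 3 * K * d\<^sup>2 * (2 * \<bar>d\<bar>)"
    by (simp add: eval_nat_numeral)
  moreover have "(4 * F 0 (x + d) - F 0 (x + 2 * d) - 3 * F 0 x) / (2 * d) - F 1 x
      = (4 * F 0 (x + d) - F 0 (x + 2 * d) - 3 * F 0 x - 2 * (F 1 x * d)) / (2 * d)"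
    using assms(6) by (simp add: field_simps)
  ultimately show ?thesis
    using assms(6) by (simp add: abs_divide abs_mult pos_divide_le_eq)
qed

text \<open>The scheme differentiates \<open>ln h\<close> by central differences, which requires
  three bounded derivatives of the logarithm. They are written out by the quotient rule, with
  denominators that are powers of the positive function \<open>F 0\<close>.\<close>

lemma derivs_on_ln:
  assumes "derivs_on 4 {a..b} F K" "\<And>x. x \<in> {a..b} \<Longrightarrow> F 0 x > 0"
  obtains G K' where "derivs_on 3 {a..b} G K'" "\<And>x. G 0 x = ln (F 0 x)" "\<And>x. G 1 x = F 1 x / F 0 x"
proof -
  define G where "G i x = (if i = 0 then ln (F 0 x) else if i = 1 then F 1 x / F 0 x
     else if i = 2 then (F 2 x * F 0 x - F 1 x * F 1 x) / (F 0 x * F 0 x)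
     else ((F 3 x * F 0 x - F 1 x * F 2 x) * (F 0 x * F 0 x)
         - (F 2 x * F 0 x - F 1 x * F 1 x) * (F 1 x * F 0 x + F 1 x * F 0 x)) / ((F 0 x * F 0 x) * (F 0 x * F 0 x)))"
    for i :: nat and x
  have d: "(F i has_real_derivative F (Suc i) x) (at x within {a..b})" if "i < 4" "x \<in> {a..b}" for i x
    using assms(1) that by (simp add: derivs_on_def)
  have "(G i has_real_derivative G (Suc i) x) (at x within {a..b})" if "i < 3" and x: "x \<in> {a..b}" for i x
  proof -
    have d0: "(F 0 has_real_derivative F 1 x) (at x within {a..b})"
      and d1: "(F 1 has_real_derivative F 2 x) (at x within {a..b})"
      and d2: "(F 2 has_real_derivative F 3 x) (at x within {a..b})"
      using d[of 0 x] d[of 1 x] d[of 2 x] x by (simp_all add: eval_nat_numeral)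
    have pos: "F 0 x > 0" using assms(2) x by simp
    consider "i = 0" | "i = 1" | "i = 2" using \<open>i < 3\<close> by linarith
    then show ?thesis
    proof cases
      case 1
      have "((\<lambda>x. ln (F 0 x)) has_real_derivative F 1 x / F 0 x) (at x within {a..b})"
        using pos by (auto intro!: derivative_eq_intros d0)
      with 1 show ?thesis by (simp add: G_def[abs_def])
    next
      case 2
      have "((\<lambda>x. F 1 x / F 0 x) has_real_derivative (F 2 x * F 0 x - F 1 x * F 1 x) / (F 0 x * F 0 x)) (at x within {a..b})"
        using pos by (auto intro!: derivative_eq_intros d0 d1[simplified])
      with 2 show ?thesis by (simp add: G_def[abs_def])
    next
      case 3
      have "((\<lambda>x. (F 2 x * F 0 x - F 1 x * F 1 x) / (F 0 x * F 0 x)) has_real_derivative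
          ((F 3 x * F 0 x - F 1 x * F 2 x) * (F 0 x * F 0 x)
         - (F 2 x * F 0 x - F 1 x * F 1 x) * (F 1 x * F 0 x + F 1 x * F 0 x)) / ((F 0 x * F 0 x) * (F 0 x * F 0 x)))
         (at x within {a..b})"
        using pos by (auto intro!: derivative_eq_intros d0 d1[simplified] d2 simp: algebra_simps)
      with 3 show ?thesis by (simp add: G_def[abs_def])
    qed
  qed
  \<comment> \<open>The bounds come from continuity on a compact interval, so no explicit lower
    bound for \<open>F 0\<close> enters. Continuity of \<open>F 3\<close> is deduced from its
    differentiability, which is where the fourth order is used.\<close>
  moreover have "\<exists>B. \<forall>x\<in>{a..b}. \<bar>G i x\<bar> \<le> B" if "i \<le> 3" for i
  proof -
    have ne: "F 0 x \<noteq> 0" if "x \<in> {a..b}" for x using assms(2)[OF that] by simp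
    have c: "continuous_on {a..b} (F 0)" "continuous_on {a..b} (F 1)" "continuous_on {a..b} (F 2)" "continuous_on {a..b} (F 3)"
      by (rule DERIV_continuous_on, rule d; simp)+
    consider "i = 0" | "i = 1" | "i = 2" | "i = 3" using \<open>i \<le> 3\<close> by linarith
    then have "continuous_on {a..b} (G i)"
      by cases (simp_all add: G_def[abs_def], (intro continuous_intros c c[simplified] ballI; use ne in simp)+)
    then have "bounded (G i ` {a..b})"
      using compact_continuous_image compact_imp_bounded compact_Icc by blast
    then show ?thesis by (auto simp: bounded_iff)
  qed
  then obtain B where B: "\<And>i. i \<le> 3 \<Longrightarrow> \<forall>x\<in>{a..b}. \<bar>G i x\<bar> \<le> B i" by metis
  have "\<bar>G i x\<bar> \<le> Max (B ` {..3})" if "i \<le> 3" "x \<in> {a..b}" for i x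
  proof -
    have "B i \<le> Max (B ` {..3})" using that by (intro Max_ge) auto
    with B[OF that(1)] that(2) show ?thesis by force
  qed
  ultimately have "derivs_on 3 {a..b} G (Max (B ` {..3}))"
    by (auto simp: derivs_on_def)
  moreover have "G 0 x = ln (F 0 x)" "G 1 x = F 1 x / F 0 x" for x
    by (simp_all add: G_def)
  ultimately show ?thesis by (rule that)
qed

section \<open>Exponential time updates\<close>

lemma exp_minus_linear_bound:
  fixes y :: real
  assumes "\<bar>y\<bar> \<le> 1"
  shows "\<bar>exp y - 1 - y\<bar> \<le> 3 * y\<^sup>2"
proof -
  \<comment> \<open>The constant sequence \<open>exp\<close> is its own chain of derivatives,
    bounded by \<open>exp 1\<close> on the interval from -1 to 1, so the general Taylor estimate
    applies; then \<open>exp 1 \<le> 3\<close>.\<close>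
  have "derivs_on (Suc 1) {-1..1} (\<lambda>_. exp) (exp (1::real))"
    by (auto simp: derivs_on_def intro!: derivative_eq_intros)
  from derivs_on_taylor[OF this, of 0 y] assms
  have "\<bar>exp y - 1 - y\<bar> \<le> exp 1 * y\<^sup>2"
    by (simp add: power2_eq_square abs_le_iff algebra_simps)
  also have "\<dots> \<le> 3 * y\<^sup>2"
    by (intro mult_right_mono exp_le) simp
  finally show ?thesis .
qed

text \<open>The error splits into three parts: the nonlinearity of the exponential, the error
  \<open>e - e0\<close> of the discrete exponent, and the Taylor remainder of \<open>u\<close> in
  time. They give the summands with \<open>12 * C ^ 3\<close>, the square of \<open>C\<close>, and
  \<open>C\<close>, in this order. As \<open>\<bar>e\<bar> \<le> 2 * C\<close>, the condition
  \<open>s * (2 * C) \<le> 1\<close> keeps \<open>s * e\<close> where the quadratic bound for the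
  exponential is valid.\<close>

lemma exp_step_consistency:
  fixes a e e0 u s d C :: real
  assumes "\<bar>e - e0\<bar> \<le> C * d\<^sup>2" "\<bar>e0\<bar> \<le> C" "\<bar>a\<bar> \<le> C" "\<bar>u - a - s * (a * e0)\<bar> \<le> C * s\<^sup>2"
    and "0 \<le> s" "s * (2 * C) \<le> 1" "d\<^sup>2 \<le> 1"
  shows "\<bar>a * exp (s * e) - u\<bar> \<le> (12 * C ^ 3 + C\<^sup>2 + C) * (s * (s + d\<^sup>2))"
proof -
  have C: "0 \<le> C" using assms(2) by simp
  then have "C * d\<^sup>2 \<le> C" using assms(7) by (simp add: mult_left_le)
  then have e: "\<bar>e\<bar> \<le> 2 * C" using assms(1,2) by linarith
  have se: "\<bar>s * e\<bar> \<le> s * (2 * C)"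
    unfolding abs_mult using assms(5) e by (intro mult_mono) auto
  then have "\<bar>exp (s * e) - 1 - s * e\<bar> \<le> 3 * (s * e)\<^sup>2"
    using assms(6) by (intro exp_minus_linear_bound) simp
  also have "(s * e)\<^sup>2 \<le> (s * (2 * C))\<^sup>2"
    using se by (metis abs_ge_zero power2_abs power_mono)
  finally have "\<bar>exp (s * e) - 1 - s * e\<bar> \<le> 12 * C\<^sup>2 * s\<^sup>2"
    by (simp add: power_mult_distrib mult_ac)
  then have "\<bar>a * (exp (s * e) - 1 - s * e)\<bar> \<le> C * (12 * C\<^sup>2 * s\<^sup>2)"
    unfolding abs_mult using assms(3) C by (intro mult_mono) auto
  then have 1: "\<bar>a * (exp (s * e) - 1 - s * e)\<bar> \<le> 12 * C ^ 3 * s\<^sup>2"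
    by (simp add: eval_nat_numeral)
  have "\<bar>s * a * (e - e0)\<bar> \<le> s * C * (C * d\<^sup>2)"
    unfolding abs_mult using assms C by (intro mult_mono) auto
  then have 2: "\<bar>s * a * (e - e0)\<bar> \<le> C\<^sup>2 * (s * d\<^sup>2)"
    by (simp add: power2_eq_square mult_ac)
  have "a * exp (s * e) - u = a * (exp (s * e) - 1 - s * e) + s * a * (e - e0) - (u - a - s * (a * e0))"
    by (simp add: algebra_simps)
  then have "\<bar>a * exp (s * e) - u\<bar> \<le> 12 * C ^ 3 * s\<^sup>2 + C\<^sup>2 * (s * d\<^sup>2) + C * s\<^sup>2"
    using 1 2 assms(4) by linarith
  also have "\<dots> \<le> (12 * C ^ 3 + C\<^sup>2 + C) * (s * (s + d\<^sup>2))"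
  proof -
    have "0 \<le> C ^ 3 * (s * d\<^sup>2)" "0 \<le> C\<^sup>2 * s\<^sup>2" "0 \<le> C * (s * d\<^sup>2)"
      using C assms(5) by simp_all
    then show ?thesis by (simp add: algebra_simps power2_eq_square)
  qed
  finally show ?thesis .
qed

section \<open>Consistency of the grid steps\<close>

text \<open>The line lemma is applied once in direction \<open>(1, 0)\<close> and once in direction
  \<open>(0, 1)\<close>. The first use gives the time expansion with a remainder uniform in
  \<open>x\<close>, since the second time derivative is bounded on the whole rectangle. The second
  gives the space derivatives of the initial profile. The maximum of both bounds serves as the
  common constant.\<close>

lemma Ck_on_rectangle_expansions:
  assumes "Ck_on 4 ({0..T} \<times> {0..1}) (\<lambda>(t, x). u t x)" "0 < T"
  shows "\<exists>ut K F. (\<forall>x\<in>{0..1}. ((\<lambda>s. u s x) has_real_derivative ut x) (at 0 within {0..T})) \<and>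
    (\<forall>x\<in>{0..1}. \<forall>s\<in>{0..T}. \<bar>u s x - u 0 x - s * ut x\<bar> \<le> K * s\<^sup>2) \<and>
    derivs_on 4 {0..1} F K \<and> F 0 = u 0"
proof -
  let ?S = "{0..T} \<times> {0..1::real}"
  have S: "compact ?S" by (intro compact_Times compact_Icc)
  obtain g K where g0: "g 0 = (\<lambda>(t, x). u t x)" and gK: "\<forall>i\<le>4. \<forall>x\<in>?S. \<bar>g i x\<bar> \<le> K"
    and gd: "\<forall>i<4. \<forall>p A. (\<forall>r\<in>A. p + r *\<^sub>R (1, 0) \<in> ?S) \<longrightarrow> (\<forall>s\<in>A.
       ((\<lambda>r. g i (p + r *\<^sub>R (1, 0))) has_real_derivative g (Suc i) (p + s *\<^sub>R (1, 0))) (at s within A))"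
    using Ck_on_line_derivs[OF assms(1) S, of "(1, 0)"] by (elim exE conjE) (rule that)
  obtain G L where G0: "G 0 = (\<lambda>(t, x). u t x)" and GL: "\<forall>i\<le>4. \<forall>x\<in>?S. \<bar>G i x\<bar> \<le> L"
    and Gd: "\<forall>i<4. \<forall>p A. (\<forall>r\<in>A. p + r *\<^sub>R (0, 1) \<in> ?S) \<longrightarrow> (\<forall>s\<in>A.
       ((\<lambda>r. G i (p + r *\<^sub>R (0, 1))) has_real_derivative G (Suc i) (p + s *\<^sub>R (0, 1))) (at s within A))"
    using Ck_on_line_derivs[OF assms(1) S, of "(0, 1)"] by (elim exE conjE) (rule that)
  have dt: "((\<lambda>r. g i (r, x)) has_real_derivative g (Suc i) (s, x)) (at s within {0..T})"
    if "i < 4" "x \<in> {0..1}" "s \<in> {0..T}" for i x s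
    using gd[rule_format, of i "{0..T}" "(0, x)" s] that by simp
  have dx: "((\<lambda>r. G i (0, r)) has_real_derivative G (Suc i) (0, s)) (at s within {0..1})"
    if "i < 4" "s \<in> {0..1}" for i s
    using Gd[rule_format, of i "{0..1}" "(0, 0)" s] that assms(2) by simp
  define F where "F i x = G i (0, x)" for i x
  have F: "derivs_on 4 {0..1} F (max K L)"
    unfolding derivs_on_def F_def using dx GL assms(2) by (auto simp: le_max_iff_disj)
  have F0: "F 0 = u 0" by (simp add: F_def fun_eq_iff G0)
  have ut: "((\<lambda>s. u s x) has_real_derivative g 1 (0, x)) (at 0 within {0..T})" if "x \<in> {0..1}" for x
    using dt[of 0 x 0] that assms(2) g0 by simp
  have uK: "\<bar>u s x - u 0 x - s * g 1 (0, x)\<bar> \<le> max K L * s\<^sup>2" if x: "x \<in> {0..1}" and s: "s \<in> {0..T}" for x s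
  proof (rule taylor_order1[OF _ _ _ s, where f = "\<lambda>r. u r x" and f' = "\<lambda>r. g 1 (r, x)" and f'' = "\<lambda>r. g 2 (r, x)"])
    fix r assume r: "r \<in> {0..T}"
    show "((\<lambda>r. u r x) has_real_derivative g 1 (r, x)) (at r within {0..T})"
      using dt[of 0 x r] x r g0 by simp
    show "((\<lambda>r. g 1 (r, x)) has_real_derivative g 2 (r, x)) (at r within {0..T})"
      using dt[of 1 x r] x r by (simp add: numeral_2_eq_2)
    have "\<bar>g 2 (r, x)\<bar> \<le> K" using gK r x by simp
    then show "\<bar>g 2 (r, x)\<bar> \<le> max K L" by simp
  qed
  show ?thesis
    by (intro exI[of _ "\<lambda>x. g 1 (0, x)"] exI[of _ "max K L"] exI[of _ F]) (use ut uK F F0 in blast)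
qed

section \<open>The equations in non-conservative form at time 0\<close>

lemma partial_t_eq:
  assumes "((\<lambda>s. u s x) has_real_derivative D) (at t within {0..T})" "0 < T" "t \<in> {0..T}"
  shows "partial_t T u t x = D"
  unfolding partial_t_def
  using assms by (intro vector_derivative_within_closed_interval) (simp_all add: has_real_derivative_iff_has_vector_derivative)

lemma partial_x_eq:
  assumes "((\<lambda>y. u t y) has_real_derivative D) (at x within {0..1})" "x \<in> {0..1}"
  shows "partial_x u t x = D"
  unfolding partial_x_def
  using assms by (intro vector_derivative_within_closed_interval) (simp_all add: has_real_derivative_iff_has_vector_derivative)

text \<open>All conservative terms are expanded by the product rule. Inserting the mass equation
  into the momentum equation cancels the term with the square of \<open>v\<close> and one of the two
  copies of \<open>h v v_x\<close>. What remains can be divided by \<open>h > 0\<close>. The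
  quotient \<open>hx / h\<close> is kept because it is the derivative of \<open>ln h\<close>, the
  quantity that the scheme discretizes.\<close>

lemma time_derivatives_nonconservative:
  fixes h v :: "real \<Rightarrow> real \<Rightarrow> real"
  assumes "0 < T" and x: "x \<in> {0..1}" and pos: "h 0 x > 0"
    and hx: "\<And>y. y \<in> {0..1} \<Longrightarrow> (h 0 has_real_derivative hx y) (at y within {0..1})"
    and vx: "\<And>y. y \<in> {0..1} \<Longrightarrow> (v 0 has_real_derivative vx y) (at y within {0..1})"
    and vxx: "(vx has_real_derivative vxx) (at x within {0..1})"
    and ht: "((\<lambda>s. h s x) has_real_derivative ht) (at 0 within {0..T})"
    and vt: "((\<lambda>s. v s x) has_real_derivative vt) (at 0 within {0..T})"
    and mass: "partial_t T h 0 x + partial_x (\<lambda>t x. h t x * v t x) 0 x = 0"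
    and momentum: "partial_t T (\<lambda>t x. h t x * v t x) 0 x
           + partial_x (\<lambda>t x. h t x * (v t x)\<^sup>2 + 1/2 * (h t x)\<^sup>2) 0 x
         = \<mu> * partial_x (\<lambda>t x. h t x * partial_x v t x) 0 x + h 0 x * f"
  shows "ht = h 0 x * (- vx x - v 0 x * (hx x / h 0 x))"
    and "vt = \<mu> * vxx + \<mu> * (vx x * (hx x / h 0 x)) - v 0 x * vx x - hx x + f"
proof -
  have T: "0 \<in> {0..T}" using assms(1) by simp
  have 1: "partial_t T h 0 x = ht"
    by (rule partial_t_eq[where u = h, OF ht assms(1) T])
  have 2: "partial_x (\<lambda>t x. h t x * v t x) 0 x = hx x * v 0 x + h 0 x * vx x"
    by (rule partial_x_eq[OF _ x]) (auto intro!: derivative_eq_intros hx[OF x] vx[OF x])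
  have 3: "partial_t T (\<lambda>t x. h t x * v t x) 0 x = ht * v 0 x + h 0 x * vt"
    by (rule partial_t_eq[OF _ assms(1) T]) (auto intro!: derivative_eq_intros ht vt)
  have 4: "partial_x (\<lambda>t x. h t x * (v t x)\<^sup>2 + 1/2 * (h t x)\<^sup>2) 0 x
      = hx x * (v 0 x)\<^sup>2 + h 0 x * (2 * v 0 x * vx x) + h 0 x * hx x"
    by (rule partial_x_eq[OF _ x]) (auto intro!: derivative_eq_intros hx[OF x] vx[OF x])
  have 5: "partial_x (\<lambda>t x. h t x * partial_x v t x) 0 x = hx x * vx x + h 0 x * vxx"
  proof (rule partial_x_eq[OF _ x])
    \<comment> \<open>The functions \<open>partial_x v 0\<close> and \<open>vx\<close> are known to
      agree only on the closed unit interval. The derivative is therefore computed with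
      \<open>vx\<close> and transferred within that interval.\<close>
    have "((\<lambda>y. h 0 y * vx y) has_real_derivative hx x * vx x + h 0 x * vxx) (at x within {0..1})"
      by (auto intro!: derivative_eq_intros hx[OF x] vxx)
    then show "((\<lambda>y. h 0 y * partial_x v 0 y) has_real_derivative hx x * vx x + h 0 x * vxx) (at x within {0..1})"
      by (rule has_field_derivative_transform_within[where d = 1])
         (use x in \<open>auto simp: partial_x_eq[where u = v, OF vx]\<close>)
  qed
  have ht': "ht = - hx x * v 0 x - h 0 x * vx x"
    using mass 1 2 by linarith
  moreover have "h 0 x * (hx x / h 0 x) = hx x" using pos by simp
  ultimately show "ht = h 0 x * (- vx x - v 0 x * (hx x / h 0 x))"
    using pos by (simp add: right_diff_distrib mult.left_commute)
  have "ht * v 0 x + h 0 x * vt + (hx x * (v 0 x)\<^sup>2 + h 0 x * (2 * v 0 x * vx x) + h 0 x * hx x)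
      = \<mu> * (hx x * vx x + h 0 x * vxx) + h 0 x * f"
    using momentum 3 4 5 by simp
  then have "h 0 x * vt = h 0 x * (\<mu> * vxx + \<mu> * (vx x * (hx x / h 0 x)) - v 0 x * vx x - hx x + f)"
    using pos unfolding ht' by (simp add: algebra_simps power2_eq_square)
  then show "vt = \<mu> * vxx + \<mu> * (vx x * (hx x / h 0 x)) - v 0 x * vx x - hx x + f"
    using pos by simp
qed

section \<open>Local errors of the level and velocity updates\<close>

lemma grid_point: "i \<le> n \<Longrightarrow> real i * (1 / real n) \<in> {0..1}"
  by (cases "n = 0") (auto simp: divide_le_eq)

text \<open>Every case of the update has the form \<open>h x * exp (s * e)\<close>, where
  \<open>e\<close> approximates the exact rate \<open>- V 1 x - V 0 x * L 1 x\<close> to second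
  order in \<open>d\<close>. At the walls \<open>v = 0\<close> removes both the logarithmic term and
  the value \<open>3 * F 0 x\<close> from the one-sided quotient. The claim is then
  \<open>exp_step_consistency\<close> with \<open>C\<close> equal to three times the square of
  \<open>K\<close>, which also explains the restriction on \<open>s\<close>.\<close>

lemma h_step_consistency:
  fixes V L :: "nat \<Rightarrow> real \<Rightarrow> real"
  assumes V: "derivs_on 3 {0..1} V K" and L: "derivs_on 3 {0..1} L K" and K: "1 \<le> K"
    and h: "\<And>y. y \<in> {0..1} \<Longrightarrow> 0 < h y" "\<And>y. y \<in> {0..1} \<Longrightarrow> L 0 y = ln (h y)" "\<bar>h x\<bar> \<le> K"
    and V0: "V 0 0 = 0" "V 0 1 = 0"
    and n: "2 \<le> n" "i \<le> n" and d: "d = 1 / real n" and x: "x = real i * d"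
    and u: "\<bar>u - h x - s * (h x * (- V 1 x - V 0 x * L 1 x))\<bar> \<le> K * s\<^sup>2"
    and s: "0 \<le> s" "s * (6 * K\<^sup>2) \<le> 1"
  shows "\<bar>h_step n s d (\<lambda>j. h (real j * d)) (\<lambda>j. V 0 (real j * d)) i - u\<bar>
    \<le> (12 * (3 * K\<^sup>2) ^ 3 + (3 * K\<^sup>2)\<^sup>2 + 3 * K\<^sup>2) * (s * (s + d\<^sup>2))"
proof -
  have d0: "0 < d" "real n * d = 1" using n d by simp_all
  moreover have "2 * d \<le> real n * d" using n d0 by (intro mult_right_mono) auto
  ultimately have d2: "2 * d \<le> 1" "d \<le> 1" by linarith+
  have x01: "x \<in> {0..1}" using grid_point[of i n] n d x by simp
  have KK: "K \<le> K\<^sup>2" using K by (simp add: power2_eq_square)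
  then have Kd: "3 * K * d\<^sup>2 \<le> 3 * K\<^sup>2 * d\<^sup>2" by (intro mult_right_mono) auto
  have "\<exists>e. h_step n s d (\<lambda>j. h (real j * d)) (\<lambda>j. V 0 (real j * d)) i = h x * exp (s * e)
      \<and> \<bar>e - (- V 1 x - V 0 x * L 1 x)\<bar> \<le> 3 * K\<^sup>2 * d\<^sup>2"
  proof -
    consider "i = 0" | "i = n" "0 < i" | "0 < i" "i < n" using n by linarith
    then show ?thesis
    proof cases
      case 1
      then have "\<bar>(4 * V 0 d - V 0 (2 * d)) / (2 * d) - V 1 0\<bar> \<le> 3 * K * d\<^sup>2"
        using one_sided_difference[OF V, of 0 d] d0 d2 V0 by simp
      then have "\<bar>(V 0 (2 * d) - 4 * V 0 d) / (2 * d) - (- V 1 0)\<bar> \<le> 3 * K\<^sup>2 * d\<^sup>2"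
        using Kd unfolding diff_divide_distrib by linarith
      with 1 show ?thesis
        using x V0 by (intro exI[of _ "(V 0 (2 * d) - 4 * V 0 d) / (2 * d)"]) (simp add: h_step_def)
    next
      case 2
      then have x1: "x = 1" using x d0 by simp
      \<comment> \<open>The subtractions on naturals are genuine since \<open>2 \<le> n\<close>. At
        the right wall the one-sided formula is applied with the negative step \<open>- d\<close>,
        which reflects the stencil.\<close>
      have g: "real (n - 1) * d = 1 - d" "real (n - 2) * d = 1 - 2 * d"
        using n d0 by (simp_all add: algebra_simps)
      have "\<bar>(4 * V 0 (1 + - d) - V 0 (1 + 2 * - d) - 3 * V 0 1) / (2 * - d) - V 1 1\<bar> \<le> 3 * K * (- d)\<^sup>2"
        using d0 d2 by (intro one_sided_difference[OF V]) auto
      then have "\<bar>- ((4 * V 0 (1 - d) - V 0 (1 - 2 * d)) / (2 * d)) - V 1 1\<bar> \<le> 3 * K * d\<^sup>2"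
        using V0 by simp
      then have "\<bar>(4 * V 0 (1 - d) - V 0 (1 - 2 * d)) / (2 * d) - (- V 1 1)\<bar> \<le> 3 * K\<^sup>2 * d\<^sup>2"
        using Kd by linarith
      with 2 show ?thesis
        using x1 V0 d0 g by (intro exI[of _ "(4 * V 0 (1 - d) - V 0 (1 - 2 * d)) / (2 * d)"]) (simp add: h_step_def)
    next
      case 3
      have g: "real (i - 1) * d = x - d" "real (i + 1) * d = x + d"
        using 3 x by (simp_all add: algebra_simps)
      have xd: "x - d \<in> {0..1}" "x + d \<in> {0..1}"
        using 3 d grid_point[of "i - 1" n] grid_point[of "i + 1" n] unfolding g[symmetric] by auto
      define a where "a = (V 0 (x + d) - V 0 (x - d)) / (2 * d)"
      define b where "b = (L 0 (x + d) - L 0 (x - d)) / (2 * d)"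
      have a: "\<bar>a - V 1 x\<bar> \<le> K * d\<^sup>2"
        unfolding a_def using x01 xd d0 by (intro central_difference[OF V]) auto
      have b: "\<bar>b - L 1 x\<bar> \<le> K * d\<^sup>2"
        unfolding b_def using x01 xd d0 by (intro central_difference[OF L]) auto
      have "\<bar>V 0 x * (b - L 1 x)\<bar> \<le> K * (K * d\<^sup>2)"
        unfolding abs_mult using b derivs_on_bound[OF V, of 0 x] x01 K by (intro mult_mono) auto
      then have "\<bar>V 0 x * b - V 0 x * L 1 x\<bar> \<le> K\<^sup>2 * d\<^sup>2"
        by (simp add: power2_eq_square algebra_simps)
      moreover have "K * d\<^sup>2 \<le> K\<^sup>2 * d\<^sup>2" "0 \<le> K\<^sup>2 * d\<^sup>2" using KK by (intro mult_right_mono) auto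
      ultimately have e: "\<bar>(- a - V 0 x * b) - (- V 1 x - V 0 x * L 1 x)\<bar> \<le> 3 * K\<^sup>2 * d\<^sup>2"
        using a by linarith
      have "ln (h (x - d) / h (x + d)) = - (b * (2 * d))"
        using h(1)[OF xd(1)] h(1)[OF xd(2)] h(2)[OF xd(1)] h(2)[OF xd(2)] d0 by (simp add: b_def ln_div)
      then have "s / (2 * d) * (V 0 (x - d) - V 0 (x + d)) + s / (2 * d) * V 0 x * ln (h (x - d) / h (x + d))
          = s * (- a - V 0 x * b)"
        using d0 by (simp add: a_def field_simps)
      then have "h_step n s d (\<lambda>j. h (real j * d)) (\<lambda>j. V 0 (real j * d)) i = h x * exp (s * (- a - V 0 x * b))"
        using 3 by (simp only: h_step_def g x[symmetric]) simp
      with e show ?thesis by blast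
    qed
  qed
  then obtain e where e: "h_step n s d (\<lambda>j. h (real j * d)) (\<lambda>j. V 0 (real j * d)) i = h x * exp (s * e)"
    "\<bar>e - (- V 1 x - V 0 x * L 1 x)\<bar> \<le> 3 * K\<^sup>2 * d\<^sup>2" by blast
  have B: "\<bar>V 0 x\<bar> \<le> K" "\<bar>V 1 x\<bar> \<le> K" "\<bar>L 1 x\<bar> \<le> K"
    using derivs_on_bound[OF V, of _ x] derivs_on_bound[OF L, of _ x] x01 by simp_all
  then have "\<bar>V 0 x * L 1 x\<bar> \<le> K\<^sup>2"
    unfolding abs_mult power2_eq_square using K by (intro mult_mono) auto
  then have e0: "\<bar>- V 1 x - V 0 x * L 1 x\<bar> \<le> 3 * K\<^sup>2"
    using B(2) KK K by linarith
  \<comment> \<open>Because \<open>1 \<le> K\<close>, bounds linear in \<open>K\<close> are absorbed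
    into the single constant required by \<open>exp_step_consistency\<close>.\<close>
  have "K * s\<^sup>2 \<le> 3 * K\<^sup>2 * s\<^sup>2"
    using KK K by (intro mult_right_mono) auto
  then have "\<bar>u - h x - s * (h x * (- V 1 x - V 0 x * L 1 x))\<bar> \<le> 3 * K\<^sup>2 * s\<^sup>2"
    using u by linarith
  moreover have "\<bar>h x\<bar> \<le> 3 * K\<^sup>2" using h(3) KK K by linarith
  moreover have "d\<^sup>2 \<le> 1" using d0 d2 by (simp add: power_le_one)
  ultimately show ?thesis
    unfolding e(1) using s by (intro exp_step_consistency[OF e(2) e0]) simp_all
qed

text \<open>At an interior node the update equals \<open>V 0 x\<close> plus \<open>s\<close> times
  the right-hand side of the velocity equation with all space derivatives replaced by the quotients
  \<open>m\<close>, \<open>a\<close>, \<open>b\<close>, \<open>c\<close>. Their individual errors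
  add up, and the time remainder accounts for the rest. At the walls the update and the exact value
  are both zero. The second difference is what requires four derivatives of
  \<open>V\<close>.\<close>

lemma v_step_consistency:
  fixes V L H :: "nat \<Rightarrow> real \<Rightarrow> real"
  assumes V: "derivs_on 4 {0..1} V K" and L: "derivs_on 3 {0..1} L K" and H: "derivs_on 3 {0..1} H K"
    and K: "1 \<le> K" and "0 < \<mu>"
    and h: "\<And>y. y \<in> {0..1} \<Longrightarrow> 0 < H 0 y" "\<And>y. y \<in> {0..1} \<Longrightarrow> L 0 y = ln (H 0 y)"
    and n: "2 \<le> n" "i \<le> n" and d: "d = 1 / real n" and x: "x = real i * d"
    and u: "\<bar>u - V 0 x - s * (\<mu> * V 2 x + \<mu> * (V 1 x * L 1 x) - V 0 x * V 1 x - H 1 x + f)\<bar> \<le> K * s\<^sup>2"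
    and u0: "i = 0 \<or> i = n \<Longrightarrow> u = 0"
    and s: "0 \<le> s"
  shows "\<bar>v_step n s d \<mu> f (\<lambda>j. H 0 (real j * d)) (\<lambda>j. V 0 (real j * d)) i - u\<bar>
    \<le> (\<mu> * K + 3 * \<mu> * K\<^sup>2 + K\<^sup>2 + 2 * K) * (s * (s + d\<^sup>2))"
proof (cases "i = 0 \<or> i = n")
  case True
  then show ?thesis using u0 assms(4,5) s by (simp add: v_step_def)
next
  case False
  have d0: "0 < d" "real n * d = 1" using n d by simp_all
  moreover have "1 * d \<le> real n * d" using n d0 by (intro mult_right_mono) auto
  ultimately have d1: "d \<le> 1" by linarith
  have x01: "x \<in> {0..1}" using grid_point[of i n] n d x by simp
  have V3: "derivs_on 3 {0..1} V K" by (rule derivs_on_mono[OF V]) simp_all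
  have g: "real (i - 1) * d = x - d" "real (i + 1) * d = x + d"
    using False x by (simp_all add: algebra_simps)
  have xd: "x - d \<in> {0..1}" "x + d \<in> {0..1}"
    using False n d grid_point[of "i - 1" n] grid_point[of "i + 1" n] unfolding g[symmetric] by auto
  define a where "a = (V 0 (x + d) - V 0 (x - d)) / (2 * d)"
  define b where "b = (L 0 (x + d) - L 0 (x - d)) / (2 * d)"
  define c where "c = (H 0 (x + d) - H 0 (x - d)) / (2 * d)"
  define m where "m = (V 0 (x + d) + V 0 (x - d) - 2 * V 0 x) / d\<^sup>2"
  have a: "\<bar>a - V 1 x\<bar> \<le> K * d\<^sup>2"
    unfolding a_def using x01 xd d0 by (intro central_difference[OF V3]) auto
  have b: "\<bar>b - L 1 x\<bar> \<le> K * d\<^sup>2"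
    unfolding b_def using x01 xd d0 by (intro central_difference[OF L]) auto
  have c: "\<bar>c - H 1 x\<bar> \<le> K * d\<^sup>2"
    unfolding c_def using x01 xd d0 by (intro central_difference[OF H]) auto
  have m: "\<bar>m - V 2 x\<bar> \<le> K * d\<^sup>2"
    unfolding m_def using x01 xd d0 by (intro second_difference[OF V]) auto
  have B: "\<bar>V 0 x\<bar> \<le> K" "\<bar>V 1 x\<bar> \<le> K" "\<bar>L 1 x\<bar> \<le> K"
    using derivs_on_bound[OF V, of _ x] derivs_on_bound[OF L, of _ x] x01 by simp_all
  have "d\<^sup>2 \<le> 1" using d0 d1 by (simp add: power_le_one)
  then have "K * d\<^sup>2 \<le> K" using K by (simp add: mult_left_le)
  then have b2: "\<bar>b\<bar> \<le> 2 * K" using b B(3) by linarith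
  have "\<bar>(a - V 1 x) * b\<bar> \<le> (K * d\<^sup>2) * (2 * K)"
    unfolding abs_mult using a b2 K by (intro mult_mono) auto
  moreover have "\<bar>V 1 x * (b - L 1 x)\<bar> \<le> K * (K * d\<^sup>2)"
    unfolding abs_mult using b B K by (intro mult_mono) auto
  \<comment> \<open>The error of a product of two quotients is split by adding and subtracting
    \<open>V 1 x * b\<close>. The bound \<open>2 * K\<close> for \<open>b\<close> comes from
    \<open>d \<le> 1\<close>.\<close>
  moreover have "a * b - V 1 x * L 1 x = (a - V 1 x) * b + V 1 x * (b - L 1 x)"
    by (simp add: algebra_simps)
  ultimately have ab: "\<bar>a * b - V 1 x * L 1 x\<bar> \<le> 3 * K\<^sup>2 * d\<^sup>2"
    by (simp add: power2_eq_square mult_ac)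
  have va: "\<bar>V 0 x * (a - V 1 x)\<bar> \<le> K * (K * d\<^sup>2)"
    unfolding abs_mult using a B K by (intro mult_mono) auto
  let ?scheme = "\<mu> * m + \<mu> * (a * b) - V 0 x * a - c + f"
  let ?exact = "\<mu> * V 2 x + \<mu> * (V 1 x * L 1 x) - V 0 x * V 1 x - H 1 x + f"
  let ?C = "\<mu> * K + 3 * \<mu> * K\<^sup>2 + K\<^sup>2 + K"
  have "\<bar>\<mu> * (m - V 2 x)\<bar> \<le> \<mu> * (K * d\<^sup>2)" "\<bar>\<mu> * (a * b - V 1 x * L 1 x)\<bar> \<le> \<mu> * (3 * K\<^sup>2 * d\<^sup>2)"
    unfolding abs_mult using m ab assms(5) by (intro mult_mono; simp)+
  moreover have "?scheme - ?exact = \<mu> * (m - V 2 x) + \<mu> * (a * b - V 1 x * L 1 x) - V 0 x * (a - V 1 x) - (c - H 1 x)"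
    unfolding right_diff_distrib by linarith
  ultimately have "\<bar>?scheme - ?exact\<bar> \<le> \<mu> * (K * d\<^sup>2) + \<mu> * (3 * K\<^sup>2 * d\<^sup>2) + K * (K * d\<^sup>2) + K * d\<^sup>2"
    using va c by linarith
  also have "\<dots> = ?C * d\<^sup>2"
    by (simp add: algebra_simps power2_eq_square)
  finally have "\<bar>s * (?scheme - ?exact)\<bar> \<le> s * (?C * d\<^sup>2)"
    unfolding abs_mult using s by (intro mult_mono) auto
  \<comment> \<open>The logarithm of the ratio is \<open>2 * d\<close> times the central quotient
    \<open>b\<close>, and the velocity increment is \<open>2 * d * a\<close>. The factor 1/4 in the
    scheme thus turns the logarithmic term into exactly \<open>\<mu> * (a * b)\<close>.\<close>
  moreover have "v_step n s d \<mu> f (\<lambda>j. H 0 (real j * d)) (\<lambda>j. V 0 (real j * d)) i = V 0 x + s * ?scheme"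
  proof -
    have "ln (H 0 (x + d) / H 0 (x - d)) = b * (2 * d)"
      using h(1)[OF xd(1)] h(1)[OF xd(2)] h(2)[OF xd(1)] h(2)[OF xd(2)] d0 by (simp add: b_def ln_div)
    then have "v_step n s d \<mu> f (\<lambda>j. H 0 (real j * d)) (\<lambda>j. V 0 (real j * d)) i
      = (1 - 2 * s * \<mu> / d\<^sup>2) * V 0 x + s * \<mu> / d\<^sup>2 * (V 0 (x + d) + V 0 (x - d))
           + s * \<mu> / (4 * d\<^sup>2) * (V 0 (x + d) - V 0 (x - d)) * (b * (2 * d))
           - s / (2 * d) * (V 0 x * (V 0 (x + d) - V 0 (x - d)) + H 0 (x + d) - H 0 (x - d)) + f * s"
      using False by (simp only: v_step_def g x[symmetric]) simp
    also have "\<dots> = V 0 x + s * ?scheme"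
      using d0 by (simp add: a_def c_def m_def field_simps power2_eq_square)
    finally show ?thesis .
  qed
  ultimately have "\<bar>v_step n s d \<mu> f (\<lambda>j. H 0 (real j * d)) (\<lambda>j. V 0 (real j * d)) i - u\<bar>
      \<le> s * (?C * d\<^sup>2) + K * s\<^sup>2"
    using u right_diff_distrib[of s ?scheme ?exact] by linarith
  also have "\<dots> \<le> (?C + K) * (s * (s + d\<^sup>2))"
  proof -
    have "0 \<le> ?C * s\<^sup>2" "0 \<le> K * (s * d\<^sup>2)" using K s assms(5) by simp_all
    then show ?thesis by (simp add: algebra_simps power2_eq_square)
  qed
  finally show ?thesis by (simp add: algebra_simps)
qed

section \<open>Consistency of the full step\<close>

text \<open>This is the common core of both observer updates: \<open>p\<close> is the plant update,
  \<open>y\<close> the exact observer state, \<open>y 0 - p0\<close> the initial estimation error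
  and \<open>c\<close> the sine coefficient. The hypothesis on \<open>y\<close> says that its slope
  at 0 equals the plant slope \<open>p'\<close> plus the initial slope of the damped oscillation.
  Hence zeroth and first order terms cancel and three quadratic remainders add up.\<close>

lemma observer_step_consistency:
  fixes p g :: "real \<Rightarrow> real"
  assumes "Ck_on N {0..T} y" "N \<ge> 2" "0 < T" "\<gamma> > 0"
    and y: "(y has_real_derivative p' + (c * (1 / sqrt 2) - \<gamma> * (y 0 - p0))) (at 0 within {0..T})"
    and p: "\<And>s. s \<in> {0..T} \<Longrightarrow> \<bar>p s - p0 - s * p'\<bar> \<le> P * s\<^sup>2"
  obtains K where "\<And>s. s \<in> {0..T} \<Longrightarrow>
    \<bar>p s + exp (- \<gamma> * s) * (cos (s / sqrt 2) * (y 0 - p0) + sin (s / sqrt 2) * c) - y s\<bar> \<le> K * s\<^sup>2"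
proof -
  obtain A where A: "\<And>s. s \<in> {0..T} \<Longrightarrow>
      \<bar>y s - y 0 - s * (p' + (c * (1 / sqrt 2) - \<gamma> * (y 0 - p0)))\<bar> \<le> A * s\<^sup>2"
    using Ck_on_taylor_order1[OF assms(1-3) y] by blast
  obtain B where B: "\<And>s. s \<ge> 0 \<Longrightarrow>
      \<bar>exp (- \<gamma> * s) * (cos (s * (1 / sqrt 2)) * (y 0 - p0) + sin (s * (1 / sqrt 2)) * c) - (y 0 - p0)
        - s * (c * (1 / sqrt 2) - \<gamma> * (y 0 - p0))\<bar> \<le> B * s\<^sup>2"
    using damped_oscillation_taylor_order1[of \<gamma> "1 / sqrt 2" "y 0 - p0" c] assms(4) by (meson less_imp_le)
  have "\<bar>p s + exp (- \<gamma> * s) * (cos (s / sqrt 2) * (y 0 - p0) + sin (s / sqrt 2) * c) - y s\<bar> \<le> (A + B + P) * s\<^sup>2"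
    if s: "s \<in> {0..T}" for s
  proof -
    define E where "E = exp (- \<gamma> * s) * (cos (s / sqrt 2) * (y 0 - p0) + sin (s / sqrt 2) * c)"
    define r where "r = c * (1 / sqrt 2) - \<gamma> * (y 0 - p0)"
    have "\<bar>E - (y 0 - p0) - s * r\<bar> \<le> B * s\<^sup>2"
      using B[of s] s by (simp add: E_def r_def)
    moreover have "\<bar>y s - y 0 - (s * p' + s * r)\<bar> \<le> A * s\<^sup>2"
      using A[OF s] by (simp add: r_def distrib_left)
    moreover have "\<bar>p s - p0 - s * p'\<bar> \<le> P * s\<^sup>2"
      by (rule p[OF s])
    ultimately have "\<bar>p s + E - y s\<bar> \<le> A * s\<^sup>2 + B * s\<^sup>2 + P * s\<^sup>2"
      by linarith
    then show ?thesis by (simp add: E_def distrib_right)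
  qed
  then show ?thesis by (rule that)
qed

lemma xih_step_consistency:
  assumes "Ck_on N {0..T} xih" "N \<ge> 2" "0 < T" "\<gamma> > 0"
    and "(xih has_real_derivative wh - 2 * \<gamma> * (xih 0 - xi)) (at 0 within {0..T})"
  obtains K where "\<And>s. s \<in> {0..T} \<Longrightarrow> \<bar>xih_step s \<gamma> f xi w (xih 0) wh - xih s\<bar> \<le> K * s\<^sup>2"
proof -
  \<comment> \<open>The observer equation is rewritten as plant slope plus oscillation slope. The
    factor \<open>sqrt 2\<close> in the sine coefficient compensates the frequency
    \<open>1 / sqrt 2\<close>.\<close>
  have eq: "wh - 2 * \<gamma> * (xih 0 - xi)
      = w + (sqrt 2 * (wh - w - \<gamma> * (xih 0 - xi)) * (1 / sqrt 2) - \<gamma> * (xih 0 - xi))"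
    by simp
  have "\<bar>xi_step s f xi w - xi - s * w\<bar> \<le> (\<bar>f\<bar> / 2) * s\<^sup>2" for s
    by (simp add: xi_step_def abs_mult)
  then obtain K where "\<And>s. s \<in> {0..T} \<Longrightarrow> \<bar>xi_step s f xi w + exp (- \<gamma> * s) * (cos (s / sqrt 2) * (xih 0 - xi)
      + sin (s / sqrt 2) * (sqrt 2 * (wh - w - \<gamma> * (xih 0 - xi)))) - xih s\<bar> \<le> K * s\<^sup>2"
    using observer_step_consistency[OF assms(1-4) assms(5)[unfolded eq], of "\<lambda>s. xi_step s f xi w"] by blast
  then show ?thesis
    using that[of K] by (simp add: xih_step_def mult_ac)
qed

lemma wh_step_consistency:
  assumes "Ck_on N {0..T} wh" "N \<ge> 2" "0 < T" "\<gamma> > 0"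
    and "(wh has_real_derivative - f - (1/2 + \<gamma>\<^sup>2) * (xih - xi)) (at 0 within {0..T})"
  obtains K where "\<And>s. s \<in> {0..T} \<Longrightarrow> \<bar>wh_step s \<gamma> f xi w xih (wh 0) - wh s\<bar> \<le> K * s\<^sup>2"
proof -
  \<comment> \<open>The terms in \<open>wh 0 - w\<close> cancel, and
    \<open>\<gamma> * (\<gamma> + 1 / (2 * \<gamma>))\<close> produces the gain of the observer
    equation; here \<open>\<gamma>\<close> must be nonzero.\<close>
  have eq: "- f - (1/2 + \<gamma>\<^sup>2) * (xih - xi)
      = - f + (\<gamma> * sqrt 2 * (wh 0 - w - (\<gamma> + 1 / (2 * \<gamma>)) * (xih - xi)) * (1 / sqrt 2) - \<gamma> * (wh 0 - w))"
    using assms(4) by (simp add: field_simps power2_eq_square)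
  \<comment> \<open>The update of \<open>w\<close> is affine in the time step, so its remainder
    constant is zero.\<close>
  have "\<bar>w_step s f w - w - s * (- f)\<bar> \<le> 0 * s\<^sup>2" for s
    by (simp add: w_step_def)
  then obtain K where "\<And>s. s \<in> {0..T} \<Longrightarrow> \<bar>w_step s f w + exp (- \<gamma> * s) * (cos (s / sqrt 2) * (wh 0 - w)
      + sin (s / sqrt 2) * (\<gamma> * sqrt 2 * (wh 0 - w - (\<gamma> + 1 / (2 * \<gamma>)) * (xih - xi)))) - wh s\<bar> \<le> K * s\<^sup>2"
    using observer_step_consistency[OF assms(1-4) assms(5)[unfolded eq], of "\<lambda>s. w_step s f w"] by blast
  then show ?thesis
    using that[of K] by (simp add: wh_step_def mult_ac)
qed

text \<open>The two local estimates are instantiated with one constant \<open>K\<close> dominating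
  all bounds on the initial profiles, their logarithm and the time remainders. Since
  \<open>K\<close> comes from the solution alone, the result is uniform in the node
  \<open>i\<close>, in \<open>n\<close> and in \<open>s\<close>. The scalar \<open>f\<close> stands
  for the feedback value at time 0.\<close>

lemma grid_step_consistency:
  fixes h v :: "real \<Rightarrow> real \<Rightarrow> real"
  assumes "0 < T" "0 < \<mu>"
    and hC: "Ck_on 4 ({0..T} \<times> {0..1}) (\<lambda>(t, x). h t x)"
    and vC: "Ck_on 4 ({0..T} \<times> {0..1}) (\<lambda>(t, x). v t x)"
    and pos: "\<And>x. x \<in> {0..1} \<Longrightarrow> 0 < h 0 x"
    and v0: "\<And>t. t \<in> {0..T} \<Longrightarrow> v t 0 = 0 \<and> v t 1 = 0"
    and mass: "\<And>x. x \<in> {0..1} \<Longrightarrow> partial_t T h 0 x + partial_x (\<lambda>t x. h t x * v t x) 0 x = 0"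
    and momentum: "\<And>x. x \<in> {0..1} \<Longrightarrow> partial_t T (\<lambda>t x. h t x * v t x) 0 x
           + partial_x (\<lambda>t x. h t x * (v t x)\<^sup>2 + 1/2 * (h t x)\<^sup>2) 0 x
         = \<mu> * partial_x (\<lambda>t x. h t x * partial_x v t x) 0 x + h 0 x * f"
  obtains C \<epsilon> where "\<epsilon> > 0"
    "\<And>s n i. 0 \<le> s \<Longrightarrow> s \<le> T \<Longrightarrow> s \<le> \<epsilon> \<Longrightarrow> 2 \<le> n \<Longrightarrow> i \<le> n \<Longrightarrow>
       \<bar>h_step n s (1 / real n) (\<lambda>j. h 0 (real j * (1 / real n))) (\<lambda>j. v 0 (real j * (1 / real n))) i
          - h s (real i * (1 / real n))\<bar>
       + \<bar>v_step n s (1 / real n) \<mu> f (\<lambda>j. h 0 (real j * (1 / real n))) (\<lambda>j. v 0 (real j * (1 / real n))) i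
          - v s (real i * (1 / real n))\<bar>
       \<le> C * (s * (s + (1 / real n)\<^sup>2))"
proof -
  obtain ht Kh H where ht: "\<forall>x\<in>{0..1}. ((\<lambda>s. h s x) has_real_derivative ht x) (at 0 within {0..T})"
    and h_taylor: "\<forall>x\<in>{0..1}. \<forall>s\<in>{0..T}. \<bar>h s x - h 0 x - s * ht x\<bar> \<le> Kh * s\<^sup>2"
    and H: "derivs_on 4 {0..1} H Kh" and H0: "H 0 = h 0"
    using Ck_on_rectangle_expansions[OF hC assms(1)] by (elim exE conjE) (rule that)
  obtain vt Kv V where vt: "\<forall>x\<in>{0..1}. ((\<lambda>s. v s x) has_real_derivative vt x) (at 0 within {0..T})"
    and v_taylor: "\<forall>x\<in>{0..1}. \<forall>s\<in>{0..T}. \<bar>v s x - v 0 x - s * vt x\<bar> \<le> Kv * s\<^sup>2"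
    and V: "derivs_on 4 {0..1} V Kv" and V0: "V 0 = v 0"
    using Ck_on_rectangle_expansions[OF vC assms(1)] by (elim exE conjE) (rule that)
  obtain L Kl where L: "derivs_on 3 {0..1} L Kl" and L0: "\<And>x. L 0 x = ln (H 0 x)" and L1: "\<And>x. L 1 x = H 1 x / H 0 x"
    using derivs_on_ln[OF H] pos unfolding H0 by blast
  define K where "K = max (max Kh Kv) (max Kl 1)"
  have K: "Kh \<le> K" "Kv \<le> K" "Kl \<le> K" "1 \<le> K" by (simp_all add: K_def)
  have dH: "(h 0 has_real_derivative H 1 y) (at y within {0..1})" if "y \<in> {0..1}" for y
    using H that by (simp add: derivs_on_def H0[symmetric])
  have dV: "(v 0 has_real_derivative V 1 y) (at y within {0..1})"
    "(V 1 has_real_derivative V 2 y) (at y within {0..1})" if "y \<in> {0..1}" for y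
    using V that by (simp_all add: derivs_on_def V0[symmetric] numeral_2_eq_2)
  have ht_eq: "ht x = h 0 x * (- V 1 x - V 0 x * L 1 x)"
    and vt_eq: "vt x = \<mu> * V 2 x + \<mu> * (V 1 x * L 1 x) - V 0 x * V 1 x - H 1 x + f" if x: "x \<in> {0..1}" for x
    using time_derivatives_nonconservative[OF assms(1) x pos[OF x] dH dV(1) dV(2)[OF x]
        ht[rule_format, OF x] vt[rule_format, OF x] mass[OF x] momentum[OF x]]
    by (simp_all only: L1 H0 V0)
  define C where "C = (12 * (3 * K\<^sup>2) ^ 3 + (3 * K\<^sup>2)\<^sup>2 + 3 * K\<^sup>2) + (\<mu> * K + 3 * \<mu> * K\<^sup>2 + K\<^sup>2 + 2 * K)"
  \<comment> \<open>This threshold is the smallness condition on \<open>s\<close> in the exponential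
    level update. The difference quotients hold for every \<open>n \<ge> 2\<close>.\<close>
  define \<epsilon> where "\<epsilon> = 1 / (6 * K\<^sup>2)"
  have "\<epsilon> > 0" using K(4) by (simp add: \<epsilon>_def)
  moreover have "\<bar>h_step n s d (\<lambda>j. h 0 (real j * d)) (\<lambda>j. v 0 (real j * d)) i - h s (real i * d)\<bar>
       + \<bar>v_step n s d \<mu> f (\<lambda>j. h 0 (real j * d)) (\<lambda>j. v 0 (real j * d)) i - v s (real i * d)\<bar>
       \<le> C * (s * (s + d\<^sup>2))"
    if s: "0 \<le> s" "s \<le> T" "s \<le> \<epsilon>" and n: "2 \<le> n" "i \<le> n" and d: "d = 1 / real n" for s n i d
  proof -
    define x where "x = real i * d"
    have x: "x \<in> {0..1}" using grid_point[OF n(2)] by (simp add: x_def d)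
    have sT: "s \<in> {0..T}" using s by simp
    have sK: "s * (6 * K\<^sup>2) \<le> 1"
      using s(3) K(4) by (simp add: \<epsilon>_def pos_le_divide_eq)
    have mono: "Kh * s\<^sup>2 \<le> K * s\<^sup>2" "Kv * s\<^sup>2 \<le> K * s\<^sup>2"
      using K by (intro mult_right_mono; simp)+
    have DV: "derivs_on 4 {0..1} V K" "derivs_on 3 {0..1} V K"
      using K by (auto intro: derivs_on_mono[OF V])
    have DH: "derivs_on 3 {0..1} H K" using K by (auto intro: derivs_on_mono[OF H])
    have DL: "derivs_on 3 {0..1} L K" using K by (auto intro: derivs_on_mono[OF L])
    have Hpos: "0 < H 0 y" if "y \<in> {0..1}" for y using pos[OF that] H0 by simp
    have uh: "\<bar>h s x - H 0 x - s * (H 0 x * (- V 1 x - V 0 x * L 1 x))\<bar> \<le> K * s\<^sup>2"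
      using h_taylor[rule_format, OF x sT] mono(1) ht_eq[OF x] H0 by simp
    have uv: "\<bar>v s x - V 0 x - s * (\<mu> * V 2 x + \<mu> * (V 1 x * L 1 x) - V 0 x * V 1 x - H 1 x + f)\<bar> \<le> K * s\<^sup>2"
      using v_taylor[rule_format, OF x sT] mono(2) vt_eq[OF x] V0 by simp
    have u0: "v s x = 0" if "i = 0 \<or> i = n"
      using that v0[OF sT] n d by (auto simp: x_def)
    have V00: "V 0 0 = 0" "V 0 1 = 0" using v0[of 0] assms(1) V0 by auto
    have "\<bar>H 0 x\<bar> \<le> K" using derivs_on_bound[OF DH, of 0 x] x by simp
    then have "\<bar>h_step n s d (\<lambda>j. H 0 (real j * d)) (\<lambda>j. V 0 (real j * d)) i - h s x\<bar>
      \<le> (12 * (3 * K\<^sup>2) ^ 3 + (3 * K\<^sup>2)\<^sup>2 + 3 * K\<^sup>2) * (s * (s + d\<^sup>2))"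
      by (intro h_step_consistency[OF DV(2) DL K(4) Hpos L0 _ V00 n d x_def uh s(1) sK])
    moreover have "\<bar>v_step n s d \<mu> f (\<lambda>j. H 0 (real j * d)) (\<lambda>j. V 0 (real j * d)) i - v s x\<bar>
      \<le> (\<mu> * K + 3 * \<mu> * K\<^sup>2 + K\<^sup>2 + 2 * K) * (s * (s + d\<^sup>2))"
      by (intro v_step_consistency[OF DV(1) DL DH K(4) assms(2) Hpos L0 n d x_def uv u0 s(1)])
    ultimately show ?thesis
      unfolding H0 V0 x_def C_def distrib_right[of _ _ "s * (s + d\<^sup>2)"] by linarith
  qed
  ultimately show ?thesis using that by blast
qed

theorem theorem3:
  shows "\<exists>N::nat.
    \<forall>(\<mu>::real) (Hmax::real) (\<sigma>::real) (q::real) (k::real) (\<gamma>::real) (\<beta>::real) (lam::real) (T::real)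
     (xi :: real \<Rightarrow> real) (w :: real \<Rightarrow> real)
     (h :: real \<Rightarrow> real \<Rightarrow> real) (v :: real \<Rightarrow> real \<Rightarrow> real)
     (xih :: real \<Rightarrow> real) (wh :: real \<Rightarrow> real) (z :: real \<Rightarrow> real).
      \<mu> > 0 \<longrightarrow> Hmax > 1 \<longrightarrow> \<sigma> > 0 \<longrightarrow> q > 0 \<longrightarrow> k > 0 \<longrightarrow> \<gamma> > 0 \<longrightarrow> \<beta> > 0 \<longrightarrow> lam \<in> {0..1} \<longrightarrow> T > 0 \<longrightarrow>
      (\<forall>t\<in>{0..T}. (xi t, w t, h t, v t) \<in> X_set \<mu> Hmax q k) \<longrightarrow>
      classical_solution N T \<mu> \<sigma> q k \<gamma> \<beta> lam xi w h v xih wh z \<longrightarrow>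
      (\<exists>M>0. \<exists>\<epsilon>>0. \<forall>(\<delta>t::real) (n::nat).
        0 < \<delta>t \<longrightarrow> \<delta>t < T \<longrightarrow> \<delta>t < \<epsilon> \<longrightarrow> n \<ge> 2 \<longrightarrow> 1 / real n < \<epsilon> \<longrightarrow>
        (let \<delta>x = 1 / real n;
             hg = (\<lambda>i::nat. h 0 (real i * \<delta>x));
             vg = (\<lambda>i::nat. v 0 (real i * \<delta>x));
             f = feedback \<mu> \<sigma> q k \<gamma> lam (xi 0) (hg 0) (hg n) (xih 0) (wh 0) (z 0)
         in \<bar>xi_step \<delta>t f (xi 0) (w 0) - xi \<delta>t\<bar>
            + \<bar>w_step \<delta>t f (w 0) - w \<delta>t\<bar>
            + \<bar>z_step \<delta>t \<mu> \<beta> f (hg 0) (hg n) (z 0) - z \<delta>t\<bar>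
            + \<bar>xih_step \<delta>t \<gamma> f (xi 0) (w 0) (xih 0) (wh 0) - xih \<delta>t\<bar>
            + \<bar>wh_step \<delta>t \<gamma> f (xi 0) (w 0) (xih 0) (wh 0) - wh \<delta>t\<bar>
            + Max ((\<lambda>i. \<bar>h_step n \<delta>t \<delta>x hg vg i - h \<delta>t (real i * \<delta>x)\<bar>
                        + \<bar>v_step n \<delta>t \<delta>x \<mu> f hg vg i - v \<delta>t (real i * \<delta>x)\<bar>) ` {0..n})
            \<le> M * \<delta>t * (\<delta>t + \<delta>x\<^sup>2)))"
\<comment> \<open>Order 4 is dictated by the second difference of \<open>v\<close> and by the three
  bounded derivatives of \<open>ln h\<close>; the time expansions use two derivatives.\<close>
proof (rule exI[of _ 4], intro allI impI, goal_cases)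
  case (1 \<mu> Hmax \<sigma> q k \<gamma> \<beta> lam T xi w h v xih wh z)
  note sol = \<open>classical_solution 4 T \<mu> \<sigma> q k \<gamma> \<beta> lam xi w h v xih wh z\<close>[unfolded classical_solution_def Let_def]
  define f where "f = feedback \<mu> \<sigma> q k \<gamma> lam (xi 0) (h 0 0) (h 0 1) (xih 0) (wh 0) (z 0)"
  have T: "0 < T" "0 \<in> {0..T}" and \<gamma>: "\<gamma> > 0" and \<mu>: "\<mu> > 0" using 1 by simp_all
  have smooth: "Ck_on 4 ({0..T} \<times> {0..1}) (\<lambda>(t, x). h t x)" "Ck_on 4 ({0..T} \<times> {0..1}) (\<lambda>(t, x). v t x)"
    "Ck_on 4 {0..T} xi" "Ck_on 4 {0..T} w" "Ck_on 4 {0..T} xih" "Ck_on 4 {0..T} wh" "Ck_on 4 {0..T} z"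
    using sol by - (elim conjE, assumption)+
  have pos: "\<forall>t\<in>{0..T}. \<forall>x\<in>{0..1}. h t x > 0"
    using sol by (elim conjE)
  have pde: "\<forall>t\<in>{0..T}. \<forall>x\<in>{0..1}.
         partial_t T h t x + partial_x (\<lambda>t x. h t x * v t x) t x = 0 \<and>
         partial_t T (\<lambda>t x. h t x * v t x) t x
           + partial_x (\<lambda>t x. h t x * (v t x)\<^sup>2 + 1/2 * (h t x)\<^sup>2) t x
         = \<mu> * partial_x (\<lambda>t x. h t x * partial_x v t x) t x
           + h t x * feedback \<mu> \<sigma> q k \<gamma> lam (xi t) (h t 0) (h t 1) (xih t) (wh t) (z t)"
    using sol by (elim conjE)
  have bc: "v t 0 = 0 \<and> v t 1 = 0" if "t \<in> {0..T}" for t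
    using sol that by (elim conjE) blast
  have ode: "(xi has_real_derivative w 0) (at 0 within {0..T})"
    "(w has_real_derivative - f) (at 0 within {0..T})"
    "(xih has_real_derivative wh 0 - 2 * \<gamma> * (xih 0 - xi 0)) (at 0 within {0..T})"
    "(wh has_real_derivative - f - (1/2 + \<gamma>\<^sup>2) * (xih 0 - xi 0)) (at 0 within {0..T})"
    "(z has_real_derivative f - 1/2 * ((h 0 1)\<^sup>2 - (h 0 0)\<^sup>2) - \<beta> * (z 0 - \<mu> * (h 0 1 - h 0 0)))
       (at 0 within {0..T})"
    using sol T(2) unfolding f_def by - (elim conjE, blast)+
  obtain A1 where A1: "\<And>s. s \<in> {0..T} \<Longrightarrow> \<bar>xi s - xi 0 - s * w 0\<bar> \<le> A1 * s\<^sup>2"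
    by (rule Ck_on_taylor_order1[OF smooth(3) _ T(1) ode(1)]) auto
  obtain A2 where A2: "\<And>s. s \<in> {0..T} \<Longrightarrow> \<bar>w s - w 0 - s * (- f)\<bar> \<le> A2 * s\<^sup>2"
    by (rule Ck_on_taylor_order1[OF smooth(4) _ T(1) ode(2)]) auto
  obtain A3 where A3: "\<And>s. s \<in> {0..T} \<Longrightarrow>
      \<bar>z s - z 0 - s * (f - 1/2 * ((h 0 1)\<^sup>2 - (h 0 0)\<^sup>2) - \<beta> * (z 0 - \<mu> * (h 0 1 - h 0 0)))\<bar> \<le> A3 * s\<^sup>2"
    by (rule Ck_on_taylor_order1[OF smooth(7) _ T(1) ode(5)]) auto
  obtain A4 where A4: "\<And>s. s \<in> {0..T} \<Longrightarrow> \<bar>xih_step s \<gamma> f (xi 0) (w 0) (xih 0) (wh 0) - xih s\<bar> \<le> A4 * s\<^sup>2"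
    by (rule xih_step_consistency[OF smooth(5) _ T(1) \<gamma> ode(3)]) auto
  obtain A5 where A5: "\<And>s. s \<in> {0..T} \<Longrightarrow> \<bar>wh_step s \<gamma> f (xi 0) (w 0) (xih 0) (wh 0) - wh s\<bar> \<le> A5 * s\<^sup>2"
    by (rule wh_step_consistency[OF smooth(6) _ T(1) \<gamma> ode(4)]) auto
  obtain C \<epsilon> where \<epsilon>: "\<epsilon> > 0" and C: "\<And>s n i. 0 \<le> s \<Longrightarrow> s \<le> T \<Longrightarrow> s \<le> \<epsilon> \<Longrightarrow> 2 \<le> n \<Longrightarrow> i \<le> n \<Longrightarrow>
       \<bar>h_step n s (1 / real n) (\<lambda>j. h 0 (real j * (1 / real n))) (\<lambda>j. v 0 (real j * (1 / real n))) i
          - h s (real i * (1 / real n))\<bar>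
       + \<bar>v_step n s (1 / real n) \<mu> f (\<lambda>j. h 0 (real j * (1 / real n))) (\<lambda>j. v 0 (real j * (1 / real n))) i
          - v s (real i * (1 / real n))\<bar>
       \<le> C * (s * (s + (1 / real n)\<^sup>2))"
  proof (rule grid_step_consistency[OF T(1) \<mu> smooth(1,2)])
    show "0 < h 0 x" if "x \<in> {0..1}" for x using pos T(2) that by blast
    show "v t 0 = 0 \<and> v t 1 = 0" if "t \<in> {0..T}" for t using bc that .
    show "partial_t T h 0 x + partial_x (\<lambda>t x. h t x * v t x) 0 x = 0" if "x \<in> {0..1}" for x
      using pde T(2) that by blast
    show "partial_t T (\<lambda>t x. h t x * v t x) 0 x
           + partial_x (\<lambda>t x. h t x * (v t x)\<^sup>2 + 1/2 * (h t x)\<^sup>2) 0 x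
         = \<mu> * partial_x (\<lambda>t x. h t x * partial_x v t x) 0 x + h 0 x * f" if "x \<in> {0..1}" for x
      using pde T(2) that unfolding f_def by blast
  qed auto
  \<comment> \<open>One constant per error term. The term with \<open>\<bar>f\<bar>\<close> covers
    the quadratic correction in the \<open>xi\<close> update, and the summand 1 makes
    \<open>M\<close> positive.\<close>
  define M where "M = \<bar>A1\<bar> + \<bar>f\<bar> + \<bar>A2\<bar> + \<bar>A3\<bar> + \<bar>A4\<bar> + \<bar>A5\<bar> + \<bar>C\<bar> + 1"
  show ?case
  proof (rule exI[of _ M], rule conjI[rotated], rule exI[of _ \<epsilon>], intro conjI allI impI)
    show "M > 0" unfolding M_def by linarith
    show "\<epsilon> > 0" by (rule \<epsilon>)
    fix s :: real and n :: nat
    assume s: "0 < s" "s < T" "s < \<epsilon>" and n: "2 \<le> n"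
    define d where "d = 1 / real n"
    \<comment> \<open>\<open>S\<close> is the target rate. Since the square of \<open>s\<close> is
      at most \<open>S\<close>, every error purely quadratic in time is absorbed, with absolute
      values guarding against constants of unknown sign.\<close>
    define S where "S = s * (s + d\<^sup>2)"
    have S: "s\<^sup>2 \<le> S" using s(1) by (simp add: S_def power2_eq_square distrib_left)
    then have S0: "0 \<le> S" using zero_le_power2[of s] by linarith
    have bound: "K * s\<^sup>2 \<le> \<bar>K\<bar> * S" for K
      using S by (intro mult_mono) auto
    have sT: "s \<in> {0..T}" using s by simp
    \<comment> \<open>This identifies the last grid point with the right wall, so the feedback
      formed from \<open>hg 0\<close> and \<open>hg n\<close> is exactly the value \<open>f\<close>
      of the continuous system at time 0.\<close>
    have nd: "real n * d = 1" using n by (simp add: d_def)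
    \<comment> \<open>The quadratic term of \<open>xi_step\<close> need not match the second
      derivative of \<open>xi\<close>: it is itself of the admissible order and is simply added to
      the Taylor remainder.\<close>
    have "\<bar>xi_step s f (xi 0) (w 0) - xi s\<bar> \<le> A1 * s\<^sup>2 + \<bar>f\<bar> * s\<^sup>2"
    proof -
      have "\<bar>s\<^sup>2 / 2 * f\<bar> \<le> \<bar>f\<bar> * s\<^sup>2" by (simp add: abs_mult)
      then show ?thesis using A1[OF sT] unfolding xi_step_def by linarith
    qed
    then have 1: "\<bar>xi_step s f (xi 0) (w 0) - xi s\<bar> \<le> \<bar>A1\<bar> * S + \<bar>f\<bar> * S"
      using bound[of A1] bound[of "\<bar>f\<bar>"] by simp
    have 2: "\<bar>w_step s f (w 0) - w s\<bar> \<le> \<bar>A2\<bar> * S"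
      using A2[OF sT] bound[of A2] unfolding w_step_def by simp
    have 3: "\<bar>z_step s \<mu> \<beta> f (h 0 0) (h 0 1) (z 0) - z s\<bar> \<le> \<bar>A3\<bar> * S"
      using A3[OF sT] bound[of A3] unfolding z_step_def by linarith
    have 4: "\<bar>xih_step s \<gamma> f (xi 0) (w 0) (xih 0) (wh 0) - xih s\<bar> \<le> \<bar>A4\<bar> * S"
      using A4[OF sT] bound[of A4] by linarith
    have 5: "\<bar>wh_step s \<gamma> f (xi 0) (w 0) (xih 0) (wh 0) - wh s\<bar> \<le> \<bar>A5\<bar> * S"
      using A5[OF sT] bound[of A5] by linarith
    have 6: "Max ((\<lambda>i. \<bar>h_step n s d (\<lambda>i. h 0 (real i * d)) (\<lambda>i. v 0 (real i * d)) i - h s (real i * d)\<bar>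
        + \<bar>v_step n s d \<mu> f (\<lambda>i. h 0 (real i * d)) (\<lambda>i. v 0 (real i * d)) i - v s (real i * d)\<bar>) ` {0..n})
      \<le> \<bar>C\<bar> * S"
    proof (rule Max.boundedI, goal_cases)
      case (3 a)
      then obtain i where i: "i \<le> n"
        and a: "a = \<bar>h_step n s d (\<lambda>i. h 0 (real i * d)) (\<lambda>i. v 0 (real i * d)) i - h s (real i * d)\<bar>
          + \<bar>v_step n s d \<mu> f (\<lambda>i. h 0 (real i * d)) (\<lambda>i. v 0 (real i * d)) i - v s (real i * d)\<bar>"
        by auto
      have "a \<le> C * S"
        unfolding a S_def d_def using s n i by (intro C) auto
      also have "\<dots> \<le> \<bar>C\<bar> * S"
        using S0 by (intro mult_right_mono) auto
      finally show ?case .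
    qed auto
    have "M * s * (s + d\<^sup>2) = M * S" by (simp add: S_def)
    also have "\<dots> = \<bar>A1\<bar> * S + \<bar>f\<bar> * S + \<bar>A2\<bar> * S + \<bar>A3\<bar> * S + \<bar>A4\<bar> * S + \<bar>A5\<bar> * S + \<bar>C\<bar> * S + S"
      by (simp add: M_def distrib_right)
    finally have "\<bar>xi_step s f (xi 0) (w 0) - xi s\<bar> + \<bar>w_step s f (w 0) - w s\<bar>
        + \<bar>z_step s \<mu> \<beta> f (h 0 0) (h 0 1) (z 0) - z s\<bar>
        + \<bar>xih_step s \<gamma> f (xi 0) (w 0) (xih 0) (wh 0) - xih s\<bar>
        + \<bar>wh_step s \<gamma> f (xi 0) (w 0) (xih 0) (wh 0) - wh s\<bar>
        + Max ((\<lambda>i. \<bar>h_step n s d (\<lambda>i. h 0 (real i * d)) (\<lambda>i. v 0 (real i * d)) i - h s (real i * d)\<bar>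
        + \<bar>v_step n s d \<mu> f (\<lambda>i. h 0 (real i * d)) (\<lambda>i. v 0 (real i * d)) i - v s (real i * d)\<bar>) ` {0..n})
        \<le> M * s * (s + d\<^sup>2)"
      using 1 2 3 4 5 6 S0 by linarith
    then show "let \<delta>x = 1 / real n;
             hg = (\<lambda>i::nat. h 0 (real i * \<delta>x));
             vg = (\<lambda>i::nat. v 0 (real i * \<delta>x));
             f = feedback \<mu> \<sigma> q k \<gamma> lam (xi 0) (hg 0) (hg n) (xih 0) (wh 0) (z 0)
         in \<bar>xi_step s f (xi 0) (w 0) - xi s\<bar>
            + \<bar>w_step s f (w 0) - w s\<bar>
            + \<bar>z_step s \<mu> \<beta> f (hg 0) (hg n) (z 0) - z s\<bar>
            + \<bar>xih_step s \<gamma> f (xi 0) (w 0) (xih 0) (wh 0) - xih s\<bar>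
            + \<bar>wh_step s \<gamma> f (xi 0) (w 0) (xih 0) (wh 0) - wh s\<bar>
            + Max ((\<lambda>i. \<bar>h_step n s \<delta>x hg vg i - h s (real i * \<delta>x)\<bar>
                        + \<bar>v_step n s \<delta>x \<mu> f hg vg i - v s (real i * \<delta>x)\<bar>) ` {0..n})
            \<le> M * s * (s + \<delta>x\<^sup>2)"
      unfolding Let_def d_def[symmetric] nd of_nat_0 mult_zero_left f_def[symmetric] .
  qed
qed

end
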